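(* Let $n$ be a positive integer, $V$ an $n$-element set, and $\mathcal{F}\subseteq 2^V$ a hereditary family with $\delta(\mathcal{F})\ge 12$. If $|\mathcal{F}|\le 5.3n+1$, then $10\mid n$, $|\mathcal{F}|=5.3n+1$, and $\mathcal{F}$ is isomorphic to $\mathcal{F}_0(n,5)$ (i.e., there is a bijection $V\to[n]$ mapping $\mathcal{F}$ onto $\mathcal{F}_0(n,5)$).
   Context: A family $\mathcal{F}\subseteq 2^V$ is hereditary if $F'\subseteq F\in\mathcal{F}$ implies $F'\in\mathcal{F}$. For $x\in V$, the degree is $d_{\mathcal{F}}(x)=|\{F\in\mathcal{F}: x\in F\}|$ and $\delta(\mathcal{F})=\min_{x\in V} d_{\mathcal{F}}(x)$. For $d\ge 5$ and $n=2dk$ with $k$ a positive integer, the family $\mathcal{F}_0(n,d)\subseteq 2^{[n]}$ is defined as follows: for $i\in[2k]$ let $U_i=\{d(i-1)+1,\dots,di\}$, and set $\mathcal{F}_0(n,d)=\mathcal{G}\cup\mathcal{H}\cup\mathcal{I}$ where $\mathcal{G}=\{S: S\subseteq U_i \text{ for some } i\in[2k],\ |S|\le d-2\}$, $\mathcal{H}=\{U_i\setminus\{di\}: i\in[2k]\}$, and $\mathcal{I}=\{\{di,d(i+1)\}: i\in\{1,3,5,\dots,2k-1\}\}$. *)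

theory Defs
  imports Complex_Main
begin

definition hereditary :: "'a set set \<Rightarrow> bool" where
  "hereditary \<F> \<longleftrightarrow> (\<forall>F \<in> \<F>. \<forall>F'. F' \<subseteq> F \<longrightarrow> F' \<in> \<F>)"

definition degree :: "'a set set \<Rightarrow> 'a \<Rightarrow> nat" where
  "degree \<F> x = card {F \<in> \<F>. x \<in> F}"

definition min_degree :: "'a set \<Rightarrow> 'a set set \<Rightarrow> nat" where
  "min_degree V \<F> = Min ((degree \<F>) ` V)"

definition blockU :: "nat \<Rightarrow> nat \<Rightarrow> nat set" where
  "blockU d i = {d * (i - 1) + 1 .. d * i}"

(* F_0(n,d) with k = n / (2d) (intended for n = 2dk) *)
definition F0 :: "nat \<Rightarrow> nat \<Rightarrow> nat set set" where
  "F0 n d = (let k = n div (2 * d) in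
     {S. \<exists>i \<in> {1..2*k}. S \<subseteq> blockU d i \<and> card S \<le> d - 2}
     \<union> {blockU d i - {d * i} | i. i \<in> {1..2*k}}
     \<union> {{d * i, d * (i + 1)} | i. i \<in> {1..2*k} \<and> odd i})"

end

theory Submission
  imports Defs
begin

text \<open>
  Discharging, with all weights scaled by 120. Give each vertex $v$ the charge
  $120\sum_{v \in F \in \mathcal{F}} 1/|F|$, so that the total charge is $120(|\mathcal{F}|-1)$,
  to be compared with $636n$. If the link of $v$ has $a$ points, $b$ pairs and $c$ triples, then the
  charge is at least $120 + 60a + 40b + 30c$, and since the link has at least 12 members, this is
  below 636 only for $(a,b,c) = (4,5,2)$, with deficit 16, and $(4,6,1)$, with deficit 6. Every such
  negative vertex spreads its deficit equally over its nonnegative neighbours. A nonnegative vertex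
  can always afford what it pays, and it ends with exactly nothing only if its link is a $K_4$ of
  vertices of type $(4,6,1)$ together with one isolated point; in the extremal case these vertices,
  the hubs, are therefore matched in pairs by the isolated points, and the $K_4$s give the blocks of
  $\mathcal{F}_0(n,5)$.
\<close>

text \<open>The constant 636 is the average charge over a block of F0(n, 5): one hub of charge 660
  and four vertices of charge 630. The hub's surplus 24 is exactly what four deficits of 6 use up.
  The obstacle is that a negative vertex may have very few nonnegative neighbours, down to a single
  one for (4,6,1), while the surplus of a nonnegative vertex can be as small as 14. Two bounds are
  played against each other. On the paying side, the star of a negative vertex has one of two rigid
  shapes. They show that the deficit 16 is always split at least in two, and at least in three when
  some receiver has at most five neighbours and at most one triple. On the receiving side, a
  negative neighbour of \<open>v\<close> is a point of degree at least 2 in the graph of pairs of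
  the link of \<open>v\<close>, and of degree at least 3 if its type is (4,6,1). Many payers
  therefore force many pairs in that link, which raises the charge of \<open>v\<close>
  itself.\<close>

lemma card_Un3_ge_6:
  assumes "finite A" "finite B" "finite C"
    and "card A \<ge> 3" "card B \<ge> 3" "card C \<ge> 3"
    and "card (A \<inter> B) \<le> 1" "card (A \<inter> C) \<le> 1" "card (B \<inter> C) \<le> 1"
  shows "card (A \<union> B \<union> C) \<ge> 6"
proof -
  \<comment> \<open>Bonferroni, 9 - 3. The sets will be the edge sets of three triples, or three
    stars of edges.\<close>
  have 1: "card A + card B = card (A \<union> B) + card (A \<inter> B)"
    using assms by (intro card_Un_Int)
  have 2: "card (A \<union> B) + card C = card (A \<union> B \<union> C) + card ((A \<union> B) \<inter> C)"
    using assms by (intro card_Un_Int) auto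
  have "card ((A \<union> B) \<inter> C) \<le> card (A \<inter> C) + card (B \<inter> C)"
    by (metis Int_Un_distrib2 card_Un_le)
  with 1 2 assms show ?thesis by linarith
qed

section \<open>Edges spanned by a set\<close>

definition pairs :: "'a set \<Rightarrow> 'a set set" where
  "pairs S = {e. e \<subseteq> S \<and> card e = 2}"

lemma card_pairs: "finite S \<Longrightarrow> card (pairs S) = card S choose 2"
  unfolding pairs_def by (rule n_subsets)

lemma finite_pairs: "finite S \<Longrightarrow> finite (pairs S)"
  unfolding pairs_def by simp

lemma card_pairs_Int_le_1:
  assumes "card s = 3" "card t = 3" "s \<noteq> t"
  shows "card (pairs s \<inter> pairs t) \<le> 1"
proof -
  have fin: "finite s" "finite t" using assms card.infinite by fastforce+
  have "pairs s \<inter> pairs t = pairs (s \<inter> t)" by (auto simp: pairs_def)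
  moreover have "card (s \<inter> t) < 3"
    using assms fin by (metis Int_lower1 Int_lower2 card_seteq psubset_card_mono psubsetI linorder_not_le)
  then have "card (s \<inter> t) choose 2 \<le> 1"
    by (auto simp: choose_two less_Suc_eq numeral_3_eq_3)
  ultimately show ?thesis using fin by (simp add: card_pairs)
qed

lemma card_pairs_3: "card t = 3 \<Longrightarrow> card (pairs t) = 3"
  by (subst card_pairs) (auto simp: choose_two intro: card_ge_0_finite)

section \<open>Links\<close>

locale hereditary_family =
  fixes V :: "'a set" and \<F> :: "'a set set"
  assumes finite_V: "finite V" and sub: "\<F> \<subseteq> Pow V" and her: "hereditary \<F>"
    and deg: "\<And>v. v \<in> V \<Longrightarrow> degree \<F> v \<ge> 12"
begin

lemma mem_mono: "G \<in> \<F> \<Longrightarrow> H \<subseteq> G \<Longrightarrow> H \<in> \<F>"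
  using her by (auto simp: hereditary_def)

definition nb :: "'a \<Rightarrow> 'a set" where
  "nb v = {y. y \<noteq> v \<and> {v, y} \<in> \<F>}"

definition lk :: "nat \<Rightarrow> 'a \<Rightarrow> 'a set set" where
  "lk j v = {e. card e = j \<and> v \<notin> e \<and> insert v e \<in> \<F>}"

definition link :: "'a \<Rightarrow> 'a set set" where
  "link v = {e. v \<notin> e \<and> insert v e \<in> \<F>}"

lemma nb_sub: "nb v \<subseteq> V" using sub by (auto simp: nb_def)

lemma finite_nb [simp]: "finite (nb v)" using nb_sub finite_V finite_subset by blast

lemma nb_sym: "y \<in> nb v \<longleftrightarrow> v \<in> nb y" by (auto simp: nb_def insert_commute)

lemma mem_nb: "G \<in> \<F> \<Longrightarrow> v \<in> G \<Longrightarrow> y \<in> G \<Longrightarrow> y \<noteq> v \<Longrightarrow> y \<in> nb v"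
  unfolding nb_def using mem_mono[of G "{v, y}"] by auto

lemma link_sub: "e \<in> link v \<Longrightarrow> e \<subseteq> nb v"
  unfolding link_def using mem_nb[of "insert v e" v] by auto

lemma lk_sub: "e \<in> lk j v \<Longrightarrow> e \<subseteq> nb v"
  using link_sub[of e v] by (auto simp: link_def lk_def)

lemma finite_link [simp]: "finite (link v)"
  by (rule finite_subset[of _ "Pow (nb v)"]) (auto dest: link_sub)

lemma lk_link: "lk j v \<subseteq> link v" by (auto simp: link_def lk_def)

lemma finite_lk [simp]: "finite (lk j v)" using finite_subset[OF lk_link] by simp

lemma link_mono: "e \<in> link v \<Longrightarrow> e' \<subseteq> e \<Longrightarrow> e' \<in> link v"
  unfolding link_def using mem_mono[of "insert v e" "insert v e'"] by auto

lemma pairs_link: "e \<in> link v \<Longrightarrow> pairs e \<subseteq> lk 2 v"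
  using link_mono[of e v] by (auto simp: pairs_def lk_def link_def)

lemma degree_eq: "degree \<F> v = card (link v)"
proof -
  have "bij_betw (insert v) (link v) {G \<in> \<F>. v \<in> G}"
    by (rule bij_betw_byWitness[where f' = "\<lambda>G. G - {v}"]) (auto simp: link_def insert_absorb)
  then show ?thesis unfolding degree_def by (simp add: bij_betw_same_card)
qed

abbreviation "da v \<equiv> card (nb v)"
abbreviation "db v \<equiv> card (lk 2 v)"
abbreviation "dc v \<equiv> card (lk 3 v)"

lemma lk2_sub_pairs: "lk 2 v \<subseteq> pairs (nb v)"
proof
  fix e assume "e \<in> lk 2 v"
  then show "e \<in> pairs (nb v)" using lk_sub[of e 2 v] by (simp add: pairs_def lk_def)
qed

lemma db_le: "db v \<le> da v choose 2"
  using card_mono[OF finite_pairs lk2_sub_pairs, of v] by (simp add: card_pairs)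

text \<open>On three points a link has at most 8 members, fewer than 12.\<close>

lemma da_ge_4: assumes "v \<in> V" shows "da v \<ge> 4"
proof (rule ccontr)
  assume "\<not> ?thesis"
  then have "(2::nat) ^ da v \<le> 2 ^ 3" by (intro power_increasing) auto
  moreover have "card (link v) \<le> card (Pow (nb v))"
    by (rule card_mono) (auto dest: link_sub)
  ultimately show False using deg[OF assms] by (simp add: degree_eq card_Pow)
qed

lemma lk3_pairs:
  assumes "t \<in> lk 3 v" shows "card (pairs t) = 3" "pairs t \<subseteq> lk 2 v" "finite (pairs t)"
proof -
  show 1: "card (pairs t) = 3" using assms card_pairs_3 by (auto simp: lk_def)
  show "pairs t \<subseteq> lk 2 v" using assms pairs_link lk_link by blast
  show "finite (pairs t)" using 1 card.infinite by force
qed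

lemma lk3_Int:
  "s \<in> lk 3 v \<Longrightarrow> t \<in> lk 3 v \<Longrightarrow> s \<noteq> t \<Longrightarrow> card (pairs s \<inter> pairs t) \<le> 1"
  by (rule card_pairs_Int_le_1) (simp_all add: lk_def)

text \<open>This and the next two lemmas are the first cases of Kruskal-Katona: one, two or three
  triples have at least 3, 5 or 6 pairs in their shadow, since distinct triples share at most one
  pair.\<close>

lemma dc_1: assumes "dc v \<ge> 1" shows "db v \<ge> 3"
proof -
  obtain t where "t \<in> lk 3 v" using assms by (metis all_not_in_conv card.empty not_one_le_zero)
  then show ?thesis using card_mono[of "lk 2 v" "pairs t"] lk3_pairs[of t v] by simp
qed

lemma dc_2: assumes "dc v \<ge> 2" shows "db v \<ge> 5"
proof -
  obtain s t where st: "s \<in> lk 3 v" "t \<in> lk 3 v" "s \<noteq> t"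
    using assms by (metis card_le_Suc0_iff_eq finite_lk not_less_eq_eq numeral_2_eq_2)
  note s = lk3_pairs[OF st(1)] and t = lk3_pairs[OF st(2)]
  have "card (pairs s \<inter> pairs t) \<le> 1" using st lk3_Int by simp
  moreover have "card (pairs s) + card (pairs t) = card (pairs s \<union> pairs t) + card (pairs s \<inter> pairs t)"
    using s t by (intro card_Un_Int)
  moreover have "card (pairs s \<union> pairs t) \<le> db v" using s t by (intro card_mono) auto
  ultimately show ?thesis using s t by linarith
qed

lemma dc_3: assumes "dc v \<ge> 3" shows "db v \<ge> 6"
proof -
  obtain S where "S \<subseteq> lk 3 v" "card S = 3" using assms by (metis obtain_subset_with_card_n)
  then obtain s t u where st: "s \<in> lk 3 v" "t \<in> lk 3 v" "u \<in> lk 3 v" "s \<noteq> t" "s \<noteq> u" "t \<noteq> u"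
    by (auto simp: card_3_iff)
  note s = lk3_pairs[OF st(1)] and t = lk3_pairs[OF st(2)] and u = lk3_pairs[OF st(3)]
  have "card (pairs s \<union> pairs t \<union> pairs u) \<ge> 6"
    using s t u st lk3_Int by (intro card_Un3_ge_6) simp_all
  moreover have "card (pairs s \<union> pairs t \<union> pairs u) \<le> db v" using s t u by (intro card_mono) auto
  ultimately show ?thesis by linarith
qed

text \<open>Four points of a link face span six pairs. Hence, as long as \<open>db v\<close> is at
  most 5, the empty set and the faces counted by \<open>da\<close>, \<open>db\<close>,
  \<open>dc\<close> make up the whole link.\<close>

lemma link_large:
  assumes "e \<in> link v" "card e \<ge> 4" shows "db v \<ge> 6"
proof -
  obtain e' where e': "e' \<subseteq> e" "card e' = 4" "finite e'" using assms by (metis obtain_subset_with_card_n)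
  then have "pairs e' \<subseteq> lk 2 v" using assms link_mono pairs_link by metis
  then have "card (pairs e') \<le> db v" by (intro card_mono) auto
  then show ?thesis using e' by (simp add: card_pairs choose_two)
qed

lemma degree_le:
  assumes "db v \<le> 5" shows "card (link v) \<le> 1 + da v + db v + dc v"
proof -
  have "link v \<subseteq> {{}} \<union> (\<lambda>y. {y}) ` nb v \<union> lk 2 v \<union> lk 3 v"
  proof
    fix e assume e: "e \<in> link v"
    then have "card e < 4" using link_large assms by force
    moreover have "finite e" using e link_sub finite_subset by fastforce
    ultimately consider "e = {}" | "card e = 1" | "card e = 2" | "card e = 3"
      using card_0_eq[of e] by linarith
    then show "e \<in> {{}} \<union> (\<lambda>y. {y}) ` nb v \<union> lk 2 v \<union> lk 3 v"
    proof cases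
      case 2
      then show ?thesis using link_sub[OF e] by (auto simp: card_1_singleton_iff)
    qed (use e in \<open>auto simp: lk_def link_def\<close>)
  qed
  then have "card (link v) \<le> card ({{}} \<union> (\<lambda>y. {y}) ` nb v \<union> lk 2 v \<union> lk 3 v)"
    by (intro card_mono) auto
  also have "\<dots> \<le> card ({{}} \<union> (\<lambda>y. {y}) ` nb v \<union> lk 2 v) + dc v" by (rule card_Un_le)
  also have "\<dots> \<le> card ({{}} \<union> (\<lambda>y. {y}) ` nb v) + db v + dc v" by (intro add_right_mono card_Un_le)
  also have "\<dots> \<le> card {{}::'a set} + card ((\<lambda>y. {y}) ` nb v) + db v + dc v" by (intro add_right_mono card_Un_le)
  also have "\<dots> \<le> 1 + da v + db v + dc v" by (simp add: card_image_le)
  finally show ?thesis .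
qed

text \<open>Without triples, a link on four points has at most 1 + 4 + 6 = 11 members. This excludes
  (4,6,0), which \<open>degree_le\<close> does not reach.\<close>

lemma dc_0_da_4: assumes "v \<in> V" "da v = 4" "dc v = 0" shows False
proof -
  have "card e < 3" if e: "e \<in> link v" for e
  proof (rule ccontr)
    assume "\<not> ?thesis"
    then obtain t where "t \<subseteq> e" "card t = 3" by (metis linorder_not_less obtain_subset_with_card_n)
    then have "t \<in> lk 3 v" using link_mono[OF e] by (auto simp: lk_def link_def)
    then show False using assms by auto
  qed
  then have "link v \<subseteq> {{}} \<union> (\<lambda>y. {y}) ` nb v \<union> lk 2 v"
  proof (intro subsetI)
    fix e assume e: "e \<in> link v" and *: "\<And>e. e \<in> link v \<Longrightarrow> card e < 3"
    have "finite e" using e link_sub finite_subset by fastforce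
    then consider "e = {}" | "card e = 1" | "card e = 2"
      using *[OF e] card_0_eq[of e] by linarith
    then show "e \<in> {{}} \<union> (\<lambda>y. {y}) ` nb v \<union> lk 2 v"
    proof cases
      case 2
      then show ?thesis using link_sub[OF e] by (auto simp: card_1_singleton_iff)
    qed (use e in \<open>auto simp: lk_def link_def\<close>)
  qed
  then have "card (link v) \<le> card ({{}} \<union> (\<lambda>y. {y}) ` nb v \<union> lk 2 v)"
    by (intro card_mono) auto
  also have "\<dots> \<le> card ({{}} \<union> (\<lambda>y. {y}) ` nb v) + db v" by (rule card_Un_le)
  also have "\<dots> \<le> card {{}::'a set} + card ((\<lambda>y. {y}) ` nb v) + db v" by (intro add_right_mono card_Un_le)
  also have "\<dots> \<le> 1 + da v + db v" by (simp add: card_image_le)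
  also have "\<dots> \<le> 11" using assms db_le[of v] by (simp add: choose_two)
  finally show False using deg[OF assms(1)] by (simp add: degree_eq)
qed

text \<open>The first two cases are the negative ones. The others are separated by what they can
  afford: their charge exceeds 636 by at least 24, 14, 24, 44 and 34. The bound 260 is the value at
  (5,5,2), and 550 the value at (6,4,1).\<close>

lemma link_cases:
  assumes "v \<in> V"
  obtains "da v = 4" "db v = 5" "dc v = 2" | "da v = 4" "db v = 6" "dc v = 1"
  | "da v = 4" "db v = 6" "dc v \<ge> 2" | "da v = 5" "db v = 5" "dc v = 1"
  | "da v = 5" "db v = 6" "dc v = 0" | "da v = 5" "40 * db v + 30 * dc v \<ge> 260"
  | "da v \<ge> 6" "60 * da v + 40 * db v + 30 * dc v \<ge> 550"
proof -
  have 12: "12 \<le> card (link v)" using deg[OF assms] degree_eq by simp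
  note a4 = da_ge_4[OF assms]
  consider "db v \<le> 2" "dc v = 0" "12 \<le> 1 + da v + db v + dc v"
    | "db v = 3 \<or> db v = 4" "dc v \<le> 1" "12 \<le> 1 + da v + db v + dc v"
    | "db v = 5" "dc v \<le> 2" "12 \<le> 1 + da v + db v + dc v"
    | "db v = 6" | "db v \<ge> 7"
  proof -
    have c1: "dc v < 1" if "db v \<le> 2"
    proof (rule ccontr)
      assume "\<not> ?thesis" then show False using that dc_1[of v] by linarith
    qed
    have c2: "dc v < 2" if "db v \<le> 4"
    proof (rule ccontr)
      assume "\<not> ?thesis" then show False using that dc_2[of v] by linarith
    qed
    have c3: "dc v < 3" if "db v \<le> 5"
    proof (rule ccontr)
      assume "\<not> ?thesis" then show False using that dc_3[of v] by linarith
    qed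
    have d: "db v \<le> 5 \<Longrightarrow> 12 \<le> 1 + da v + db v + dc v" using degree_le[of v] 12 by linarith
    consider "db v \<le> 2" | "db v = 3 \<or> db v = 4" | "db v = 5" | "db v = 6" | "db v \<ge> 7" by linarith
    then show thesis
    proof cases
      case 1 then show thesis using c1 d that(1) by simp
    next
      case 2 then have "dc v < 2" "12 \<le> 1 + da v + db v + dc v" using c2 d by auto
      then show thesis using 2 by (intro that(2)) auto
    next
      case 3 then show thesis using c3 d by (intro that(3)) auto
    qed (use that in auto)
  qed
  note bcases = this
  have b4: "db v \<le> 6" if "da v = 4" using db_le[of v] that by (simp add: choose_two)
  consider "da v = 4" | "da v = 5" | "da v \<ge> 6" using a4 by linarith
  then show thesis
  proof cases
    case 1
    have "db v = 5 \<and> dc v = 2 \<or> db v = 6 \<and> dc v = 1 \<or> db v = 6 \<and> dc v \<ge> 2"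
      using bcases
    proof cases
      case 1 then have False using \<open>da v = 4\<close> by linarith
      then show ?thesis ..
    next
      case 2 then have False using \<open>da v = 4\<close> by linarith
      then show ?thesis ..
    next
      case 3 then have "dc v = 2" using \<open>da v = 4\<close> by linarith
      then show ?thesis using 3 by simp
    next
      case 4
      then have "dc v \<noteq> 0" using 1 dc_0_da_4[OF assms] by blast
      then have "dc v = 1 \<or> dc v \<ge> 2" by linarith
      with 4 show ?thesis by simp
    next
      case 5 then have False using b4 \<open>da v = 4\<close> by simp
      then show ?thesis ..
    qed
    then show thesis using 1 that by blast
  next
    case 2
    have "db v = 5 \<and> dc v = 1 \<or> db v = 6 \<and> dc v = 0 \<or> 40 * db v + 30 * dc v \<ge> 260"
      using bcases
    proof cases
      case 1 then have False using \<open>da v = 5\<close> by linarith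
      then show ?thesis ..
    next
      case 2 then have False using \<open>da v = 5\<close> by linarith
      then show ?thesis ..
    next
      case 3 then have "dc v = 1 \<or> dc v = 2" using \<open>da v = 5\<close> by linarith
      then show ?thesis using 3 by auto
    next
      case 4
      have "dc v = 0 \<or> dc v \<ge> 1" by linarith
      with 4 show ?thesis by auto
    qed auto
    then show thesis using 2 that by blast
  next
    case 3
    have "60 * da v + 40 * db v + 30 * dc v \<ge> 550"
      using bcases
    proof cases
      case 1 then show ?thesis using \<open>da v \<ge> 6\<close> by linarith
    next
      case 2 then show ?thesis using \<open>da v \<ge> 6\<close> by linarith
    next
      case 3 then show ?thesis using \<open>da v \<ge> 6\<close> by linarith
    next
      case 4 then show ?thesis using \<open>da v \<ge> 6\<close> by linarith
    next
      case 5 then show ?thesis using \<open>da v \<ge> 6\<close> by linarith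
    qed
    then show thesis using 3 that by blast
  qed
qed

section \<open>Negative vertices\<close>

definition typeA :: "'a \<Rightarrow> bool" where
  "typeA x \<longleftrightarrow> da x = 4 \<and> db x = 5 \<and> dc x = 2"

definition typeB :: "'a \<Rightarrow> bool" where
  "typeB x \<longleftrightarrow> da x = 4 \<and> db x = 6 \<and> dc x = 1"

definition Neg :: "'a set" where
  "Neg = {x \<in> V. typeA x \<or> typeB x}"

definition Pos :: "'a set" where
  "Pos = V - Neg"

text \<open>
  The shape of the star of a negative vertex. For \<open>A_at x p q r s\<close> the maximal sets through
  \<open>x\<close> are the two quadruples containing the ``centres'' \<open>p, q\<close> and one of the ``wings'' \<open>r, s\<close>. For
  \<open>B_at x p q r s\<close> they are one quadruple avoiding \<open>s\<close> and the three triples containing \<open>s\<close>.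
\<close>

definition A_at :: "'a \<Rightarrow> 'a \<Rightarrow> 'a \<Rightarrow> 'a \<Rightarrow> 'a \<Rightarrow> bool" where
  "A_at x p q r s \<longleftrightarrow> distinct [x, p, q, r, s] \<and> {x, p, q, r} \<in> \<F> \<and> {x, p, q, s} \<in> \<F> \<and>
    (\<forall>G\<in>\<F>. x \<in> G \<longrightarrow> G \<subseteq> {x, p, q, r, s} \<and> \<not> (r \<in> G \<and> s \<in> G))"

definition B_at :: "'a \<Rightarrow> 'a \<Rightarrow> 'a \<Rightarrow> 'a \<Rightarrow> 'a \<Rightarrow> bool" where
  "B_at x p q r s \<longleftrightarrow> distinct [x, p, q, r, s] \<and> {x, p, q, r} \<in> \<F> \<and>
    {x, p, s} \<in> \<F> \<and> {x, q, s} \<in> \<F> \<and> {x, r, s} \<in> \<F> \<and>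
    (\<forall>G\<in>\<F>. x \<in> G \<longrightarrow> G \<subseteq> {x, p, q, r, s} \<and> (s \<in> G \<longrightarrow> card G \<le> 3))"

lemma A_atD:
  assumes "A_at x p q r s" "G \<in> \<F>" "x \<in> G"
  shows "G \<subseteq> {x, p, q, r, s}" "\<not> (r \<in> G \<and> s \<in> G)"
  using assms unfolding A_at_def by blast+

lemma B_atD:
  assumes "B_at x p q r s" "G \<in> \<F>" "x \<in> G"
  shows "G \<subseteq> {x, p, q, r, s}" "s \<in> G \<Longrightarrow> card G \<le> 3"
  using assms unfolding B_at_def by blast+

lemma A_at_swap_centers: assumes "A_at x p q r s" shows "A_at x q p r s"
proof -
  have "{x, q, p, r} = {x, p, q, r}" "{x, q, p, s} = {x, p, q, s}" "{x, q, p, r, s} = {x, p, q, r, s}"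
    by blast+
  then show ?thesis using assms unfolding A_at_def by auto
qed

lemma A_at_swap_wings: assumes "A_at x p q r s" shows "A_at x p q s r"
proof -
  have "{x, p, q, s, r} = {x, p, q, r, s}" by blast
  then show ?thesis using assms unfolding A_at_def by auto
qed

lemma in_lk2: "insert v e \<in> \<F> \<Longrightarrow> e = {y, z} \<Longrightarrow> y \<noteq> z \<Longrightarrow> v \<noteq> y \<Longrightarrow> v \<noteq> z \<Longrightarrow> e \<in> lk 2 v"
  by (auto simp: lk_def)

lemma lk2_D: "{y, z} \<in> lk 2 v \<Longrightarrow> {v, y, z} \<in> \<F> \<and> y \<noteq> z \<and> v \<noteq> y \<and> v \<noteq> z"
  by (cases "y = z") (auto simp: lk_def)

lemma pairs_insert_mem: "y \<in> S \<Longrightarrow> z \<in> S \<Longrightarrow> y \<noteq> z \<Longrightarrow> {y, z} \<in> pairs S"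
  by (auto simp: pairs_def)

lemma subset_insert_nb: "G \<in> \<F> \<Longrightarrow> x \<in> G \<Longrightarrow> G \<subseteq> insert x (nb x)"
  using mem_nb by blast

text \<open>Exactly one of the six pairs of neighbours is missing from the link; its ends are the
  wings. Only two of the four possible triples avoid that pair, so both occur.\<close>

lemma typeA_imp_A_at:
  assumes "typeA x" shows "\<exists>p q r s. A_at x p q r s"
proof -
  have n4: "da x = 4" and b5: "db x = 5" and c2: "dc x = 2" using assms by (auto simp: typeA_def)
  have "card (pairs (nb x) - lk 2 x) = 1"
    using n4 b5 lk2_sub_pairs by (simp add: card_Diff_subset card_pairs choose_two)
  then obtain e where e: "pairs (nb x) - lk 2 x = {e}" by (auto simp: card_1_singleton_iff)
  then have "e \<subseteq> nb x" "card e = 2" "e \<notin> lk 2 x" by (auto simp: pairs_def)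
  then obtain r s where rs: "e = {r, s}" "r \<noteq> s" "r \<in> nb x" "s \<in> nb x" by (auto simp: card_2_iff)
  have "card (nb x - {r, s}) = 2" using rs n4 by (simp add: card_Diff_subset)
  then obtain p q where pq: "nb x - {r, s} = {p, q}" "p \<noteq> q" by (auto simp: card_2_iff)
  have nbx: "nb x = {p, q, r, s}" using pq rs by blast
  have dist: "distinct [x, p, q, r, s]" using pq rs nbx unfolding nb_def by auto
  have nrs: "\<not> (r \<in> G \<and> s \<in> G)" if "G \<in> \<F>" "x \<in> G" for G
  proof
    assume "r \<in> G \<and> s \<in> G"
    then have "{x, r, s} \<in> \<F>" using mem_mono[OF that(1), of "{x, r, s}"] that(2) by auto
    then have "{r, s} \<in> lk 2 x" using dist by (intro in_lk2) auto
    then show False using rs \<open>e \<notin> lk 2 x\<close> by simp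
  qed
  have "lk 3 x \<subseteq> {{p, q, r}, {p, q, s}}"
  proof
    fix t assume t: "t \<in> lk 3 x"
    then have t1: "t \<subseteq> {p, q, r, s}" "card t = 3" using lk_sub nbx by (auto simp: lk_def)
    then have "card ({p, q, r, s} - t) = 1"
      using n4 nbx finite_subset[OF t1(1)] by (simp add: card_Diff_subset)
    then obtain y where y: "{p, q, r, s} - t = {y}" by (auto simp: card_1_singleton_iff)
    have "\<not> (r \<in> t \<and> s \<in> t)" using nrs[of "insert x t"] t by (auto simp: lk_def)
    then have "y = r \<or> y = s" using y by auto
    moreover have "t = {p, q, r, s} - {y}" using y t1 by blast
    moreover have "{p, q, r, s} - {r} = {p, q, s}" "{p, q, r, s} - {s} = {p, q, r}" using dist by auto
    ultimately show "t \<in> {{p, q, r}, {p, q, s}}" by auto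
  qed
  moreover have "card {{p, q, r}, {p, q, s}} \<le> 2" by (simp add: card_insert_if)
  ultimately have "lk 3 x = {{p, q, r}, {p, q, s}}" using c2 by (intro card_seteq) auto
  then have "{p, q, r} \<in> lk 3 x" "{p, q, s} \<in> lk 3 x" by auto
  then have "{x, p, q, r} \<in> \<F>" "{x, p, q, s} \<in> \<F>" by (auto simp: lk_def)
  then have "A_at x p q r s"
    unfolding A_at_def using dist nrs subset_insert_nb[of _ x] nbx by auto
  then show ?thesis by blast
qed

text \<open>All six pairs occur, and \<open>s\<close> is the neighbour outside the only triple. A
  member with four or more points through \<open>x\<close> and \<open>s\<close> would yield a second
  triple, one containing \<open>s\<close>.\<close>

lemma typeB_imp_B_at:
  assumes "typeB x" shows "\<exists>p q r s. B_at x p q r s"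
proof -
  have n4: "da x = 4" and b6: "db x = 6" and c1: "dc x = 1" using assms by (auto simp: typeB_def)
  have P: "lk 2 x = pairs (nb x)"
    using n4 b6 lk2_sub_pairs by (intro card_subset_eq) (auto simp: finite_pairs card_pairs choose_two)
  obtain t where t: "lk 3 x = {t}" using c1 by (auto simp: card_1_singleton_iff)
  then have tin: "t \<in> lk 3 x" by simp
  then have t1: "t \<subseteq> nb x" "card t = 3" using lk_sub by (auto simp: lk_def)
  then obtain p q r where pqr: "t = {p, q, r}" "p \<noteq> q" "p \<noteq> r" "q \<noteq> r" by (auto simp: card_3_iff)
  have "card (nb x - t) = 1" using t1 n4 pqr by (simp add: card_Diff_subset)
  then obtain s where s: "nb x - t = {s}" by (auto simp: card_1_singleton_iff)
  have nbx: "nb x = {p, q, r, s}" using s t1 pqr by blast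
  have dist: "distinct [x, p, q, r, s]" using pqr s nbx unfolding nb_def by auto
  have tr: "{x, y, z} \<in> \<F>" if "y \<in> nb x" "z \<in> nb x" "y \<noteq> z" for y z
    using pairs_insert_mem[OF that] lk2_D[of y z x] P by auto
  have c3: "card G \<le> 3" if G: "G \<in> \<F>" "x \<in> G" "s \<in> G" for G
  proof (rule ccontr)
    assume "\<not> ?thesis"
    moreover have "finite G" using G sub finite_V finite_subset by blast
    ultimately have "card (G - {x, s}) \<ge> 2" using G dist by (simp add: card_Diff_subset)
    then obtain u where u: "u \<subseteq> G - {x, s}" "card u = 2" "finite u" by (metis obtain_subset_with_card_n)
    then have "s \<notin> u" "x \<notin> u" by auto
    with u have "insert s u \<in> lk 3 x"
      unfolding lk_def using dist G mem_mono[OF G(1), of "insert x (insert s u)"] by auto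
    then have "insert s u = {p, q, r}" using t pqr(1) by simp
    then have "s \<in> {p, q, r}" by blast
    then show False using dist by auto
  qed
  have "{x, p, q, r} \<in> \<F>" using tin pqr by (auto simp: lk_def)
  moreover have "{x, p, s} \<in> \<F>" "{x, q, s} \<in> \<F>" "{x, r, s} \<in> \<F>"
    using tr[of p s] tr[of q s] tr[of r s] nbx dist by auto
  ultimately have "B_at x p q r s"
    unfolding B_at_def using dist c3 subset_insert_nb[of _ x] nbx by auto
  then show ?thesis by blast
qed

lemma A_at_nb: assumes "A_at x p q r s" shows "nb x = {p, q, r, s}"
proof
  show "nb x \<subseteq> {p, q, r, s}" using assms unfolding A_at_def nb_def by fastforce
  have "{x, p, q, r} \<in> \<F>" "{x, p, q, s} \<in> \<F>" using assms by (auto simp: A_at_def)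
  then have "p \<in> nb x" "q \<in> nb x" "r \<in> nb x" "s \<in> nb x"
    using assms mem_nb by (auto simp: A_at_def)
  then show "{p, q, r, s} \<subseteq> nb x" by simp
qed

lemma B_at_nb: assumes "B_at x p q r s" shows "nb x = {p, q, r, s}"
proof
  show "nb x \<subseteq> {p, q, r, s}" using assms unfolding B_at_def nb_def by fastforce
  have "{x, p, q, r} \<in> \<F>" "{x, p, s} \<in> \<F>" using assms by (auto simp: B_at_def)
  then have "p \<in> nb x" "q \<in> nb x" "r \<in> nb x" "s \<in> nb x"
    using assms mem_nb by (auto simp: B_at_def)
  then show "{p, q, r, s} \<subseteq> nb x" by simp
qed

lemma A_at_center:
  assumes "A_at x p q r s"
  shows "{{x, q}, {x, r}, {x, s}, {q, r}, {q, s}} \<subseteq> lk 2 p" "dc p \<ge> 2"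
    "{x, q, r, s} \<subseteq> nb p"
proof -
  have d: "distinct [x, p, q, r, s]" and F: "{x, p, q, r} \<in> \<F>" "{x, p, q, s} \<in> \<F>"
    using assms by (auto simp: A_at_def)
  show "{{x, q}, {x, r}, {x, s}, {q, r}, {q, s}} \<subseteq> lk 2 p"
    using d mem_mono[OF F(1)] mem_mono[OF F(2)] by (auto simp: lk_def)
  show "{x, q, r, s} \<subseteq> nb p"
    using d mem_nb[OF F(1), of p] mem_nb[OF F(2), of p] by auto
  have "{{x, q, r}, {x, q, s}} \<subseteq> lk 3 p"
    using d F by (auto simp: lk_def insert_commute)
  then have "card {{x, q, r}, {x, q, s}} \<le> dc p" by (intro card_mono) auto
  moreover have "{x, q, r} \<noteq> {x, q, s}" using d by auto
  ultimately show "dc p \<ge> 2" by simp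
qed

text \<open>A centre lies in both quadruples, so it has two triples and, if negative, is of type A.
  Its five link edges are then all known and the missing one is again \<open>{r, s}\<close>:
  \<open>x\<close> and \<open>p\<close> exchange roles while the wings stay.\<close>

lemma A_at_center_Neg:
  assumes A: "A_at x p q r s" and N: "p \<in> Neg"
  shows "A_at p x q r s"
proof -
  note c = A_at_center[OF A]
  have d: "distinct [x, p, q, r, s]" and F: "{x, p, q, r} \<in> \<F>" "{x, p, q, s} \<in> \<F>"
    using A by (auto simp: A_at_def)
  have 4: "da p = 4" and 5: "db p = 5" using N c(2) by (auto simp: Neg_def typeA_def typeB_def)
  have nbp: "nb p = {x, q, r, s}"
    using c(3) d 4 by (intro card_seteq[symmetric]) auto
  have "card {{x, q}, {x, r}, {x, s}, {q, r}, {q, s}} = 5"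
    using d by (auto simp: card_insert_if doubleton_eq_iff)
  then have L: "lk 2 p = {{x, q}, {x, r}, {x, s}, {q, r}, {q, s}}"
    using c(1) 5 by (intro card_seteq[symmetric]) auto
  have "\<not> (r \<in> G \<and> s \<in> G)" if "G \<in> \<F>" "p \<in> G" for G
  proof
    assume "r \<in> G \<and> s \<in> G"
    then have "{p, r, s} \<in> \<F>" using mem_mono[OF that(1), of "{p, r, s}"] that(2) by auto
    then have "{r, s} \<in> lk 2 p" using d by (intro in_lk2) auto
    then show False using L d by (auto simp: doubleton_eq_iff)
  qed
  then show ?thesis unfolding A_at_def
    using d F subset_insert_nb[of _ p] nbp by (auto simp: insert_commute)
qed

lemma A_at_wing_nb: assumes "A_at x p q r s" shows "{x, p, q} \<subseteq> nb r"
proof -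
  have F: "{x, p, q, r} \<in> \<F>" "distinct [x, p, q, r, s]" using assms by (auto simp: A_at_def)
  then show ?thesis using mem_nb[OF F(1), of r] by auto
qed

text \<open>A member through both \<open>r\<close> and \<open>x\<close> avoids the other wing, so in
  the link of \<open>r\<close> the point \<open>x\<close> is confined to the triangle. By
  \<open>A_at_center_Neg\<close> the same then holds for negative centres.\<close>

lemma A_at_wing_link:
  assumes "A_at x p q r s" "e \<in> link r" "x \<in> e" shows "e \<subseteq> {x, p, q}"
proof -
  have "insert r e \<in> \<F>" "r \<notin> e" using assms(2) by (auto simp: link_def)
  then have "insert r e \<subseteq> {x, p, q, r, s}" "s \<notin> insert r e"
    using A_atD[OF assms(1), of "insert r e"] assms(3) by blast+
  with \<open>r \<notin> e\<close> show ?thesis by blast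
qed

text \<open>With \<open>x\<close> and \<open>p\<close> both confined to the triangle, a fourth
  neighbour \<open>t\<close> of \<open>r\<close> can be joined to \<open>q\<close> only. That leaves
  at most four link edges, but a negative vertex has at least five.\<close>

lemma A_at_wing_not_Neg:
  assumes A: "A_at x p q r s" and N: "p \<in> Neg"
  shows "r \<notin> Neg"
proof
  assume "r \<in> Neg"
  then have 4: "da r = 4" and 5: "db r \<ge> 5" by (auto simp: Neg_def typeA_def typeB_def)
  have d: "distinct [x, p, q, r, s]" using A by (auto simp: A_at_def)
  note n = A_at_wing_nb[OF A]
  have "card (nb r - {x, p, q}) = 1" using n d 4 by (simp add: card_Diff_subset)
  then obtain t where t: "nb r - {x, p, q} = {t}" by (auto simp: card_1_singleton_iff)
  have "lk 2 r \<subseteq> {{x, p}, {x, q}, {p, q}, {q, t}}"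
  proof
    fix e assume e: "e \<in> lk 2 r"
    then have l: "e \<in> link r" using lk_link by auto
    have "card e = 2" using e by (simp add: lk_def)
    then obtain y z where yz: "e = {y, z}" "y \<noteq> z" by (auto simp: card_2_iff)
    have s: "e \<subseteq> {x, p, q, t}" using lk_sub[OF e] t by auto
    have "x \<in> e \<Longrightarrow> e \<subseteq> {x, p, q}" by (rule A_at_wing_link[OF A l])
    moreover have "p \<in> e \<Longrightarrow> e \<subseteq> {p, x, q}" by (rule A_at_wing_link[OF A_at_center_Neg[OF A N] l])
    ultimately show "e \<in> {{x, p}, {x, q}, {p, q}, {q, t}}" using s yz by auto
  qed
  then have "db r \<le> card {{x, p}, {x, q}, {p, q}, {q, t}}" by (intro card_mono) auto
  also have "\<dots> \<le> 4" by (simp add: card_insert_if)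
  finally show False using 5 by simp
qed

text \<open>When \<open>x\<close>, \<open>p\<close>, \<open>q\<close> are all negative, the link of
  \<open>r\<close> splits into faces inside the triangle and faces avoiding it. With at most two
  further neighbours it would have at most 8 + 3 = 11 members.\<close>

lemma A_at_wing_da:
  assumes A: "A_at x p q r s" and N: "p \<in> Neg" "q \<in> Neg" and r: "r \<in> V"
  shows "da r \<ge> 6"
proof (rule ccontr)
  assume "\<not> ?thesis"
  have d: "distinct [x, p, q, r, s]" using A by (auto simp: A_at_def)
  note n = A_at_wing_nb[OF A]
  let ?M = "nb r - {x, p, q}"
  have "card ?M + 3 = da r" using n d card_mono[OF finite_nb n] by (simp add: card_Diff_subset)
  then have "(2::nat) ^ card ?M \<le> 2 ^ 2" using \<open>\<not> 6 \<le> da r\<close> by (intro power_increasing) auto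
  then have M: "card (Pow ?M - {{}}) \<le> 3" by (subst card_Diff_subset) (auto simp: card_Pow)
  have "link r \<subseteq> Pow {x, p, q} \<union> (Pow ?M - {{}})"
  proof
    fix e assume l: "e \<in> link r"
    have "x \<in> e \<Longrightarrow> e \<subseteq> {x, p, q}" by (rule A_at_wing_link[OF A l])
    moreover have "p \<in> e \<Longrightarrow> e \<subseteq> {p, x, q}" by (rule A_at_wing_link[OF A_at_center_Neg[OF A N(1)] l])
    moreover have "q \<in> e \<Longrightarrow> e \<subseteq> {q, x, p}"
      by (rule A_at_wing_link[OF A_at_center_Neg[OF A_at_swap_centers[OF A] N(2)] l])
    ultimately show "e \<in> Pow {x, p, q} \<union> (Pow ?M - {{}})" using link_sub[OF l] by auto
  qed
  then have "card (link r) \<le> card (Pow {x, p, q} \<union> (Pow ?M - {{}}))" by (intro card_mono) auto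
  also have "\<dots> \<le> card (Pow {x, p, q}) + card (Pow ?M - {{}})" by (rule card_Un_le)
  also have "card (Pow {x, p, q}) = 8" using d by (simp add: card_Pow card_insert_if)
  finally show False using M deg[OF r] by (simp add: degree_eq)
qed

section \<open>Discharging\<close>

text \<open>
  \<open>excess\<close> only counts sets of size at most 4, so it is a lower bound for the charge minus 636;
  it is negative exactly on \<open>Neg\<close>.
\<close>

definition excess :: "'a \<Rightarrow> real" where
  "excess v = 60 * real (da v) + 40 * real (db v) + 30 * real (dc v) - 516"

abbreviation "npos x \<equiv> card (nb x \<inter> Pos)"

text \<open>Meant for negative \<open>x\<close>, where \<open>npos_pos\<close> rules out division by
  zero.\<close>

definition pay :: "'a \<Rightarrow> real" where
  "pay x = - excess x / real (npos x)"

text \<open>For distinct \<open>v\<close> and \<open>y\<close> this is the number of 3-element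
  members of the family through both. It is thus symmetric, which lets the star of a negative
  \<open>y\<close> be read off in the link of \<open>v\<close>.\<close>

definition lk_deg :: "'a \<Rightarrow> 'a \<Rightarrow> nat" where
  "lk_deg v y = card {e \<in> lk 2 v. y \<in> e}"

section \<open>Nonnegative neighbours of a negative vertex and the size of its payments\<close>

lemma PosI: "y \<in> V \<Longrightarrow> y \<notin> Neg \<Longrightarrow> y \<in> Pos" by (simp add: Pos_def)

text \<open>Either both centres are nonnegative, or one is negative and then both wings are
  nonnegative by \<open>A_at_wing_not_Neg\<close>. The two bounds cap the payment at 16/2 = 8 and at
  16/3 < 6.\<close>

lemma A_at_npos:
  assumes A: "A_at x p q r s"
  shows "npos x \<ge> 2" "r \<in> Pos \<Longrightarrow> \<not> (p \<in> Neg \<and> q \<in> Neg) \<Longrightarrow> npos x \<ge> 3"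
proof -
  note n = A_at_nb[OF A]
  have V: "p \<in> V" "q \<in> V" "r \<in> V" "s \<in> V" using nb_sub[of x] n by auto
  have d: "distinct [x, p, q, r, s]" using A by (auto simp: A_at_def)
  have sub: "S \<subseteq> nb x \<Longrightarrow> S \<inter> Neg = {} \<Longrightarrow> card S \<le> npos x" for S
    using nb_sub[of x] by (intro card_mono) (auto intro: PosI)
  have wings: "r \<notin> Neg" "s \<notin> Neg" if "p \<in> Neg \<or> q \<in> Neg"
    using that A_at_wing_not_Neg[OF A] A_at_wing_not_Neg[OF A_at_swap_wings[OF A]]
      A_at_wing_not_Neg[OF A_at_swap_centers[OF A]]
      A_at_wing_not_Neg[OF A_at_swap_wings[OF A_at_swap_centers[OF A]]] by blast+
  show "npos x \<ge> 2"
    using sub[of "{p, q}"] sub[of "{r, s}"] wings n d by (cases "p \<in> Neg \<or> q \<in> Neg") auto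
  assume r: "r \<in> Pos" and pq: "\<not> (p \<in> Neg \<and> q \<in> Neg)"
  consider "p \<notin> Neg" "q \<notin> Neg" | "p \<in> Neg" "q \<notin> Neg" | "p \<notin> Neg" "q \<in> Neg" using pq by blast
  then show "npos x \<ge> 3"
  proof cases
    case 1 then show ?thesis using sub[of "{p, q, r}"] r n d by (auto simp: Pos_def)
  next
    case 2 then show ?thesis using sub[of "{q, r, s}"] wings n d by auto
  next
    case 3 then show ?thesis using sub[of "{p, r, s}"] wings n d by auto
  qed
qed

text \<open>If all neighbours were negative, \<open>s\<close> would have a triple. It cannot contain
  \<open>x\<close>, because members through \<open>x\<close> and \<open>s\<close> have at most three
  points, so it is \<open>{p, q, r}\<close>. Now \<open>p\<close> has the two triples
  \<open>{x, q, r}\<close> and \<open>{s, q, r}\<close>, which makes it type A with five link edges,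
  yet six are present.\<close>

lemma B_at_npos:
  assumes B: "B_at x p q r s"
  shows "npos x \<ge> 1"
proof (rule ccontr)
  assume "\<not> ?thesis"
  then have "nb x \<inter> Pos = {}" by (simp add: not_le)
  then have N: "p \<in> Neg" "s \<in> Neg" using B_at_nb[OF B] nb_sub[of x] PosI by auto
  have d: "distinct [x, p, q, r, s]" and F: "{x, p, q, r} \<in> \<F>" "{x, p, s} \<in> \<F>" "{x, q, s} \<in> \<F>" "{x, r, s} \<in> \<F>"
    using B by (auto simp: B_at_def)
  have "da s = 4" "dc s \<ge> 1" using N by (auto simp: Neg_def typeA_def typeB_def)
  moreover have "{x, p, q, r} \<subseteq> nb s"
    using d mem_nb[OF F(2), of s] mem_nb[OF F(3), of s] mem_nb[OF F(4), of s] by auto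
  ultimately have nbs: "nb s = {x, p, q, r}" using d by (intro card_seteq[symmetric]) auto
  have "t = {p, q, r}" if t: "t \<in> lk 3 s" for t
  proof -
    have c: "card t = 3" "s \<notin> t" "insert s t \<in> \<F>" using t by (auto simp: lk_def)
    have "x \<notin> t"
    proof
      assume "x \<in> t"
      then have "card (insert s t) \<le> 3" using B_atD(2)[OF B c(3)] by auto
      then show False using c card_ge_0_finite[of t] by simp
    qed
    then have "t \<subseteq> {p, q, r}" using lk_sub[OF t] nbs by auto
    then show ?thesis using c d by (intro card_seteq) auto
  qed
  moreover have "lk 3 s \<noteq> {}" using \<open>dc s \<ge> 1\<close> by auto
  ultimately have "{p, q, r} \<in> lk 3 s" by blast
  then have F5: "{s, p, q, r} \<in> \<F>" by (simp add: lk_def)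
  have "{{x, q, r}, {s, q, r}} \<subseteq> lk 3 p" using d F F5 by (auto simp: lk_def insert_commute)
  then have "card {{x, q, r}, {s, q, r}} \<le> dc p" by (intro card_mono) auto
  moreover have "x \<in> {x, q, r}" "x \<notin> {s, q, r}" using d by auto
  then have "{x, q, r} \<noteq> {s, q, r}" by metis
  ultimately have "dc p \<ge> 2" by simp
  then have b: "db p = 5" using N by (auto simp: Neg_def typeA_def typeB_def)
  have "{p, x, q} \<in> \<F>" "{p, x, r} \<in> \<F>" "{p, x, s} \<in> \<F>" "{p, s, q} \<in> \<F>" "{p, s, r} \<in> \<F>" "{p, q, r} \<in> \<F>"
    by (rule mem_mono[OF F(1)] mem_mono[OF F5] mem_mono[OF F(2)], blast)+
  then have "{{x, q}, {x, r}, {x, s}, {s, q}, {s, r}, {q, r}} \<subseteq> lk 2 p"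
    using d by (auto simp: lk_def)
  then have "card {{x, q}, {x, r}, {x, s}, {s, q}, {s, r}, {q, r}} \<le> db p" by (intro card_mono) auto
  moreover have "card {{x, q}, {x, r}, {x, s}, {s, q}, {s, r}, {q, r}} = 6"
    using d by (auto simp: card_insert_if doubleton_eq_iff)
  ultimately show False using b by simp
qed

lemma Neg_cases:
  assumes "x \<in> Neg"
  obtains p q r s where "typeA x" "A_at x p q r s" | p q r s where "typeB x" "B_at x p q r s"
proof -
  have "typeA x \<or> typeB x" using assms by (simp add: Neg_def)
  then show thesis
  proof
    assume "typeA x" then show thesis using typeA_imp_A_at[of x] that(1) by blast
  next
    assume "typeB x" then show thesis using typeB_imp_B_at[of x] that(2) by blast
  qed
qed

lemma npos_pos: assumes "x \<in> Neg" shows "npos x \<ge> 1"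
  using assms
proof (cases rule: Neg_cases)
  case (1 p q r s)
  then show ?thesis using A_at_npos(1)[of x p q r s] by simp
next
  case (2 p q r s)
  then show ?thesis using B_at_npos by blast
qed

lemma pay_typeA: "typeA x \<Longrightarrow> pay x = 16 / real (npos x)"
  by (simp add: pay_def excess_def typeA_def)

lemma pay_typeB: "typeB x \<Longrightarrow> pay x = 6 / real (npos x)"
  by (simp add: pay_def excess_def typeB_def)

lemma pay_typeB_le: assumes "x \<in> Neg" "typeB x" shows "pay x \<le> 6"
  using npos_pos[OF assms(1)] pay_typeB[OF assms(2)] by (simp add: divide_le_eq)

lemma pay_typeB_eq: assumes "x \<in> Neg" "typeB x" "pay x = 6" shows "npos x = 1"
  using npos_pos[OF assms(1)] pay_typeB[OF assms(2)] assms(3)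
  by (auto simp: divide_eq_eq split: if_splits)

lemma pay_le_8: assumes "x \<in> Neg" shows "pay x \<le> 8"
  using assms
proof (cases rule: Neg_cases)
  case (1 p q r s)
  then show ?thesis using A_at_npos(1)[of x p q r s] pay_typeA[of x] by (simp add: divide_le_eq)
next
  case (2 p q r s)
  then show ?thesis using pay_typeB_le[OF assms] by simp
qed

text \<open>Both centres have at least two triples, so \<open>v\<close> must be a wing; the
  symmetries of \<open>A_at\<close> move it to the third place.\<close>

lemma A_at_wing_cases:
  assumes A: "A_at x p q r s" and v: "v \<in> nb x" "dc v \<le> 1"
  obtains p' q' s' where "A_at x p' q' v s'"
proof -
  have "v \<in> {p, q, r, s}" using A_at_nb[OF A] v by simp
  moreover have "dc p \<ge> 2" "dc q \<ge> 2" using A_at_center(2) A A_at_swap_centers by blast+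
  ultimately have "v = r \<or> v = s" using v by auto
  then show thesis using A A_at_swap_wings that by blast
qed

text \<open>A type A payer has \<open>v\<close> as a wing, and \<open>A_at_wing_da\<close> prevents
  both of its centres from being negative; so it has three receivers. The bound 8 would be too weak
  for (5,5,1) and (5,6,0).\<close>

lemma pay_le_6:
  assumes x: "x \<in> Neg" and v: "v \<in> nb x" "v \<in> Pos" "dc v \<le> 1" "da v \<le> 5"
  shows "pay x \<le> 6"
  using x
proof (cases rule: Neg_cases)
  case (1 p q r s)
  obtain p' q' s' where A: "A_at x p' q' v s'" using A_at_wing_cases[OF 1(2) v(1,3)] .
  have "\<not> (p' \<in> Neg \<and> q' \<in> Neg)" using A_at_wing_da[OF A] v by (auto simp: Pos_def)
  then have "npos x \<ge> 3" using A_at_npos(2)[OF A] v by blast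
  then show ?thesis using pay_typeA[OF 1(1)] by (simp add: divide_le_eq)
next
  case (2 p q r s)
  then show ?thesis using pay_typeB_le[OF x] by simp
qed

section \<open>Degrees in the link graph and the number of negative neighbours\<close>

lemma lk_deg_sum: "(\<Sum>y\<in>nb v. lk_deg v y) = 2 * db v"
  unfolding lk_deg_def
proof (rule sum_multicount)
  show "\<forall>e\<in>lk 2 v. card {y \<in> nb v. y \<in> e} = 2"
  proof
    fix e assume e: "e \<in> lk 2 v"
    then have "{y \<in> nb v. y \<in> e} = e" using lk_sub by blast
    then show "card {y \<in> nb v. y \<in> e} = 2" using e by (simp add: lk_def)
  qed
qed simp_all

lemma card_edge_star:
  assumes "x \<notin> S" shows "card ((\<lambda>z. {x, z}) ` S) = card S"
  by (rule card_image) (auto simp: inj_on_def doubleton_eq_iff)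

lemma lk_deg_le:
  assumes "v \<in> nb x" shows "lk_deg v x \<le> da x - 1"
proof -
  have "{e \<in> lk 2 v. x \<in> e} \<subseteq> (\<lambda>z. {x, z}) ` (nb x - {v})"
  proof
    fix e assume e: "e \<in> {e \<in> lk 2 v. x \<in> e}"
    then have "card e = 2" "v \<notin> e" "x \<in> e" and F: "insert v e \<in> \<F>" by (auto simp: lk_def)
    then obtain z where z: "e = {x, z}" "z \<noteq> x" by (auto simp: card_2_iff)
    then have "z \<in> nb x" using mem_nb[OF F, of x z] by auto
    then show "e \<in> (\<lambda>z. {x, z}) ` (nb x - {v})" using z \<open>v \<notin> e\<close> by auto
  qed
  then have "lk_deg v x \<le> card ((\<lambda>z. {x, z}) ` (nb x - {v}))"
    unfolding lk_deg_def by (intro card_mono) auto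
  also have "\<dots> \<le> card (nb x - {v})" by (simp add: card_image_le)
  finally show ?thesis using assms by simp
qed

lemma all_triples_mem:
  assumes "db x = 6" "da x = 4" "y \<in> nb x" "z \<in> nb x" "y \<noteq> z"
  shows "{x, y, z} \<in> \<F>"
proof -
  have "lk 2 x = pairs (nb x)"
    using assms lk2_sub_pairs by (intro card_subset_eq) (auto simp: finite_pairs card_pairs choose_two)
  then show ?thesis using pairs_insert_mem[of y "nb x" z] lk2_D[of y z x] assms by auto
qed

text \<open>Completeness is assumed at \<open>x\<close>, the degree is taken in the link of
  \<open>v\<close>: the three triples \<open>{x, v, z}\<close> are seen from the other side.\<close>

lemma lk_deg_at_complete_nb:
  assumes "db x = 6" "da x = 4" "v \<in> nb x" shows "lk_deg v x \<ge> 3"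
proof -
  have x: "x \<notin> nb x" by (simp add: nb_def)
  have "(\<lambda>z. {x, z}) ` (nb x - {v}) \<subseteq> {e \<in> lk 2 v. x \<in> e}"
  proof
    fix e assume "e \<in> (\<lambda>z. {x, z}) ` (nb x - {v})"
    then obtain z where z: "e = {x, z}" "z \<in> nb x" "z \<noteq> v" by auto
    then have "{x, v, z} \<in> \<F>" using all_triples_mem[OF assms] by auto
    then show "e \<in> {e \<in> lk 2 v. x \<in> e}" using z x assms(3) in_lk2[of v e x z]
      by (auto simp: insert_commute)
  qed
  then have "card ((\<lambda>z. {x, z}) ` (nb x - {v})) \<le> lk_deg v x"
    unfolding lk_deg_def by (intro card_mono) auto
  then show ?thesis using x assms by (simp add: card_edge_star)
qed

text \<open>The link graph of \<open>x\<close> is a K4 without the edge \<open>{r, s}\<close>, so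
  each of its vertices has degree at least 2.\<close>

lemma lk_deg_typeA:
  assumes A: "A_at x p q r s" and v: "v \<in> nb x" shows "lk_deg v x \<ge> 2"
proof -
  have d: "distinct [x, p, q, r, s]" and F: "{x, p, q, r} \<in> \<F>" "{x, p, q, s} \<in> \<F>"
    using A by (auto simp: A_at_def)
  have *: "2 \<le> lk_deg v x" if "{{x, y}, {x, z}} \<subseteq> lk 2 v" "y \<noteq> z" for y z
  proof -
    have "card {{x, y}, {x, z}} \<le> lk_deg v x" unfolding lk_deg_def
      using that by (intro card_mono) auto
    then show ?thesis using that by (simp add: doubleton_eq_iff)
  qed
  have m: "{x, p, q} \<in> \<F>" "{x, p, r} \<in> \<F>" "{x, q, r} \<in> \<F>" "{x, p, s} \<in> \<F>" "{x, q, s} \<in> \<F>"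
    using mem_mono[OF F(1)] mem_mono[OF F(2)] by auto
  have "v \<in> {p, q, r, s}" using A_at_nb[OF A] v by simp
  then show ?thesis
    using *[of q r] *[of p r] *[of p q] d m by (auto simp: lk_def insert_commute)
qed

lemma lk_deg_Neg: assumes "x \<in> Neg" "v \<in> nb x" shows "lk_deg v x \<ge> 2"
  using assms(1)
proof (cases rule: Neg_cases)
  case (2 p q r s)
  then show ?thesis using lk_deg_at_complete_nb[of x v] assms by (simp add: typeB_def)
qed (use assms lk_deg_typeA in blast)

text \<open>Handshaking in the graph \<open>lk 2 v\<close>, where negative neighbours have degree at
  least 2.\<close>

lemma card_Neg_nb_le_db: "card (nb v \<inter> Neg) \<le> db v"
proof -
  have "2 * card (nb v \<inter> Neg) = (\<Sum>y\<in>nb v \<inter> Neg. 2)" by simp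
  also have "\<dots> \<le> (\<Sum>y\<in>nb v \<inter> Neg. lk_deg v y)"
    by (rule sum_mono) (use lk_deg_Neg nb_sym in auto)
  also have "\<dots> \<le> (\<Sum>y\<in>nb v. lk_deg v y)" by (rule sum_mono2) auto
  finally show ?thesis by (simp add: lk_deg_sum)
qed

lemma A_at_wing_lk3: assumes "A_at x p q r s" shows "{x, p, q} \<in> lk 3 r"
proof -
  have d: "distinct [x, p, q, r, s]" and "{x, p, q, r} \<in> \<F>" using assms by (auto simp: A_at_def)
  moreover have "insert r {x, p, q} = {x, p, q, r}" by blast
  ultimately show ?thesis by (auto simp: lk_def)
qed

text \<open>Every neighbour of a type A vertex lies in one of its two quadruples. Consequently the
  negative neighbours of a vertex without triples are all of type B.\<close>

lemma typeA_nb_dc: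
  assumes "typeA x" "v \<in> nb x" shows "dc v > 0"
proof (rule ccontr)
  assume v: "\<not> ?thesis"
  obtain p q r s where A: "A_at x p q r s" using typeA_imp_A_at[OF assms(1)] by blast
  obtain p' q' s' where A': "A_at x p' q' v s'" using A_at_wing_cases[OF A assms(2)] v by auto
  have "lk 3 v \<noteq> {}" using A_at_wing_lk3[OF A'] by auto
  then show False using v by (simp add: card_gt_0_iff)
qed

text \<open>All negative neighbours are of type B, hence have degree at least 3, and the degrees sum
  to 12.\<close>

lemma card_Neg_nb_le_4:
  assumes "db v = 6" "dc v = 0" shows "card (nb v \<inter> Neg) \<le> 4"
proof -
  have "3 * card (nb v \<inter> Neg) = (\<Sum>y\<in>nb v \<inter> Neg. 3)" by simp
  also have "\<dots> \<le> (\<Sum>y\<in>nb v \<inter> Neg. lk_deg v y)"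
  proof (rule sum_mono)
    fix y assume y: "y \<in> nb v \<inter> Neg"
    then show "3 \<le> lk_deg v y" using lk_deg_at_complete_nb[of y v] nb_sym[of v y]
      typeA_nb_dc[of y v] assms by (auto simp: Neg_def typeB_def)
  qed
  also have "\<dots> \<le> (\<Sum>y\<in>nb v. lk_deg v y)" by (rule sum_mono2) auto
  finally show ?thesis using assms by (simp add: lk_deg_sum)
qed

lemma star_Int: "y \<noteq> z \<Longrightarrow> card ({e \<in> lk 2 v. y \<in> e} \<inter> {e \<in> lk 2 v. z \<in> e}) \<le> 1"
proof -
  assume yz: "y \<noteq> z"
  have "{e \<in> lk 2 v. y \<in> e} \<inter> {e \<in> lk 2 v. z \<in> e} \<subseteq> {{y, z}}"
  proof
    fix e assume "e \<in> {e \<in> lk 2 v. y \<in> e} \<inter> {e \<in> lk 2 v. z \<in> e}"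
    then have "card e = 2" "y \<in> e" "z \<in> e" by (auto simp: lk_def)
    then show "e \<in> {{y, z}}" using yz by (auto simp: card_2_iff)
  qed
  then have "card ({e \<in> lk 2 v. y \<in> e} \<inter> {e \<in> lk 2 v. z \<in> e}) \<le> card {{y, z}}"
    by (intro card_mono) auto
  then show ?thesis by simp
qed

lemma A_at_wing_star:
  assumes A: "A_at x p q r s" and e: "e \<in> lk 2 r" "x \<in> e" shows "e \<subseteq> {x, p, q}"
  using A_at_wing_link[OF A subsetD[OF lk_link e(1)] e(2)] .

text \<open>Three negative neighbours would force a sixth link edge: through three stars if all are
  of type B, and through a triangle and a disjoint star otherwise. In the second case
  \<open>v\<close> is a wing, so its only triple is \<open>{x, p, q}\<close>, and
  \<open>da v = 5\<close> keeps \<open>p\<close> and \<open>q\<close> from both being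
  negative.\<close>

lemma card_Neg_nb_le_2_551:
  assumes v: "v \<in> V" "da v = 5" "db v = 5" "dc v = 1"
  shows "card (nb v \<inter> Neg) \<le> 2"
proof (rule ccontr)
  assume "\<not> ?thesis"
  then have k: "card (nb v \<inter> Neg) \<ge> 3" by simp
  have B3: "card {e \<in> lk 2 v. y \<in> e} \<ge> 3" if "y \<in> nb v" "typeB y" for y
    using lk_deg_at_complete_nb[of y v] that nb_sym[of v y] by (simp add: typeB_def lk_deg_def)
  show False
  proof (cases "\<exists>x\<in>nb v \<inter> Neg. typeA x")
    case False
    obtain Y where "Y \<subseteq> nb v \<inter> Neg" "card Y = 3" using k by (metis obtain_subset_with_card_n)
    then obtain x y z where Y: "x \<in> nb v \<inter> Neg" "y \<in> nb v \<inter> Neg" "z \<in> nb v \<inter> Neg" "x \<noteq> y" "x \<noteq> z" "y \<noteq> z"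
      by (auto simp: card_3_iff)
    have B: "typeB w" if w: "w \<in> nb v \<inter> Neg" for w
    proof -
      have "typeA w \<or> typeB w" using w by (simp add: Neg_def)
      then show ?thesis using False w by blast
    qed
    have "card ({e \<in> lk 2 v. x \<in> e} \<union> {e \<in> lk 2 v. y \<in> e} \<union> {e \<in> lk 2 v. z \<in> e}) \<ge> 6"
      using Y B B3 by (intro card_Un3_ge_6 star_Int) simp_all
    moreover have "card ({e \<in> lk 2 v. x \<in> e} \<union> {e \<in> lk 2 v. y \<in> e} \<union> {e \<in> lk 2 v. z \<in> e}) \<le> db v"
      by (intro card_mono) auto
    ultimately show False using v by simp
  next
    case True
    then obtain x where x: "x \<in> nb v" "x \<in> Neg" "typeA x" by blast
    then have vx: "v \<in> nb x" by (simp add: nb_sym)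
    obtain p0 q0 r0 s0 where "A_at x p0 q0 r0 s0" using typeA_imp_A_at[OF x(3)] by blast
    then obtain p q s where A: "A_at x p q v s" using A_at_wing_cases vx v by (metis order_refl)
    have d: "distinct [x, p, q, v, s]" using A by (auto simp: A_at_def)
    obtain t where "lk 3 v = {t}" using v by (auto simp: card_1_singleton_iff)
    then have t: "lk 3 v = {{x, p, q}}" using A_at_wing_lk3[OF A] by auto
    have "\<not> (p \<in> Neg \<and> q \<in> Neg)" using A_at_wing_da[OF A] v by auto
    \<comment> \<open>A negative neighbour outside the only triple \<open>{x, p, q}\<close> has three edges of its own,
      which with the three edges of that triple makes six.\<close>
    have "\<not> nb v \<inter> Neg \<subseteq> {x, p, q}"
    proof
      assume s: "nb v \<inter> Neg \<subseteq> {x, p, q}"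
      have "nb v \<inter> Neg = {x, p, q}"
        using k d by (intro card_seteq[OF _ s]) auto
      then show False using \<open>\<not> (p \<in> Neg \<and> q \<in> Neg)\<close> by blast
    qed
    then obtain y where y: "y \<in> nb v" "y \<in> Neg" "y \<notin> {x, p, q}" by blast
    have "\<not> typeA y"
    proof
      assume "typeA y"
      then obtain p1 q1 r1 s1 where "A_at y p1 q1 r1 s1" using typeA_imp_A_at by blast
      then obtain p' q' s' where "A_at y p' q' v s'"
        using A_at_wing_cases y(1) v nb_sym by (metis order_refl)
      then have "{y, p', q'} \<in> lk 3 v" by (rule A_at_wing_lk3)
      then show False using t y by auto
    qed
    then have "typeB y" using y by (auto simp: Neg_def)
    then have D: "card {e \<in> lk 2 v. y \<in> e} \<ge> 3" using B3 y by blast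
    have "{x, p, q} \<in> lk 3 v" using t by simp
    then have "pairs {x, p, q} \<subseteq> lk 2 v" by (rule lk3_pairs(2))
    moreover have "{{x, p}, {x, q}, {p, q}} \<subseteq> pairs {x, p, q}" using d by (auto simp: pairs_def)
    ultimately have p3: "{{x, p}, {x, q}, {p, q}} \<subseteq> lk 2 v" by (rule order_trans[rotated])
    have "{{x, p}, {x, q}, {p, q}} \<inter> {e \<in> lk 2 v. y \<in> e} = {}" using y by auto
    then have "card ({{x, p}, {x, q}, {p, q}} \<union> {e \<in> lk 2 v. y \<in> e})
        = card {{x, p}, {x, q}, {p, q}} + card {e \<in> lk 2 v. y \<in> e}"
      by (intro card_Un_disjoint) auto
    moreover have "card {{x, p}, {x, q}, {p, q}} = 3" using d by (auto simp: card_insert_if doubleton_eq_iff)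
    moreover have "card ({{x, p}, {x, q}, {p, q}} \<union> {e \<in> lk 2 v. y \<in> e}) \<le> db v"
      using p3 by (intro card_mono) auto
    ultimately show False using D v by simp
  qed
qed

text \<open>At a wing, \<open>x\<close> is joined to the two centres only. This distinguishes wings
  from centres in \<open>card_Neg_nb_le_2_462\<close>.\<close>

lemma A_at_wing_deg:
  assumes A: "A_at x p q r s" shows "lk_deg r x \<le> 2"
proof -
  have d: "distinct [x, p, q, r, s]" using A by (auto simp: A_at_def)
  have "{e \<in> lk 2 r. x \<in> e} \<subseteq> {{x, p}, {x, q}}"
  proof
    fix e assume e: "e \<in> {e \<in> lk 2 r. x \<in> e}"
    then have "card e = 2" "x \<in> e" "e \<subseteq> {x, p, q}" using A_at_wing_star[OF A] by (auto simp: lk_def)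
    then obtain z where "e = {x, z}" "z \<noteq> x" by (auto simp: card_2_iff)
    then show "e \<in> {{x, p}, {x, q}}" using \<open>e \<subseteq> {x, p, q}\<close> by auto
  qed
  then have "lk_deg r x \<le> card {{x, p}, {x, q}}" unfolding lk_deg_def by (intro card_mono) auto
  then show ?thesis by (simp add: card_insert_if split: if_splits)
qed

text \<open>Mirror image of \<open>lk_deg_at_complete_nb\<close>: here the link of \<open>v\<close>
  itself is complete.\<close>

lemma lk_deg_of_complete_link:
  assumes "db v = 6" "da v = 4" "x \<in> nb v" shows "lk_deg v x \<ge> 3"
proof -
  have "(\<lambda>z. {x, z}) ` (nb v - {x}) \<subseteq> {e \<in> lk 2 v. x \<in> e}"
  proof
    fix e assume "e \<in> (\<lambda>z. {x, z}) ` (nb v - {x})"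
    then obtain z where z: "e = {x, z}" "z \<in> nb v" "z \<noteq> x" by auto
    then have "{v, x, z} \<in> \<F>" using all_triples_mem[OF assms] by auto
    moreover have "v \<noteq> x" "v \<noteq> z" using z assms(3) by (auto simp: nb_def)
    ultimately show "e \<in> {e \<in> lk 2 v. x \<in> e}" using z by (auto simp: lk_def)
  qed
  then have "card ((\<lambda>z. {x, z}) ` (nb v - {x})) \<le> lk_deg v x"
    unfolding lk_deg_def by (intro card_mono) auto
  then show ?thesis using assms by (simp add: card_edge_star)
qed

text \<open>The surplus 24 strictly exceeds two payments of 8, but not three. Without type A
  neighbours: the two triples of \<open>v\<close> share at least two of its four neighbours, and a
  shared point lies in two quadruples with \<open>v\<close>, so it is not of type B. With a type A
  neighbour \<open>x\<close>: \<open>v\<close> is a centre of \<open>x\<close>, and neither wing of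
  \<open>x\<close> can be negative.\<close>

lemma card_Neg_nb_le_2_462:
  assumes v: "v \<in> V" "da v = 4" "db v = 6" "dc v = 2"
  shows "card (nb v \<inter> Neg) \<le> 2"
proof (cases "\<exists>x\<in>nb v \<inter> Neg. typeA x")
  case False
  obtain s t where "lk 3 v = {s, t}" "s \<noteq> t" using v(4) by (auto simp: card_2_iff)
  then have st: "s \<in> lk 3 v" "t \<in> lk 3 v" "s \<noteq> t" by auto
  then have c: "card s = 3" "card t = 3" "v \<notin> s" "v \<notin> t" "insert v s \<in> \<F>" "insert v t \<in> \<F>"
    by (auto simp: lk_def)
  have f: "finite s" "finite t" using c card_ge_0_finite[of s] card_ge_0_finite[of t] by auto
  have sub: "s \<union> t \<subseteq> nb v" using st lk_sub by blast
  have "y \<notin> Neg" if y: "y \<in> s \<inter> t" for y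
  proof
    assume "y \<in> Neg"
    then have "typeA y \<or> typeB y" by (simp add: Neg_def)
    then have "typeB y" using False y sub \<open>y \<in> Neg\<close> by blast
    have "{insert v (s - {y}), insert v (t - {y})} \<subseteq> lk 3 y"
    proof -
      have "insert y (insert v (s - {y})) = insert v s" "insert y (insert v (t - {y})) = insert v t"
        using y by auto
      moreover have "y \<noteq> v" using y c by auto
      ultimately show ?thesis using y c f by (simp add: lk_def)
    qed
    then have "card {insert v (s - {y}), insert v (t - {y})} \<le> dc y" by (intro card_mono) auto
    moreover have "insert v (s - {y}) \<noteq> insert v (t - {y})"
    proof
      assume "insert v (s - {y}) = insert v (t - {y})"
      then have "insert y (insert v (s - {y}) - {v}) = insert y (insert v (t - {y}) - {v})" by simp
      moreover have "insert y (insert v (s - {y}) - {v}) = s" "insert y (insert v (t - {y}) - {v}) = t"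
        using y c by auto
      ultimately show False using st by simp
    qed
    ultimately have "dc y \<ge> 2" by simp
    then show False using \<open>typeB y\<close> by (simp add: typeB_def)
  qed
  then have "card (nb v \<inter> Neg) \<le> card (nb v - s \<inter> t)" by (intro card_mono) auto
  also have "\<dots> = 4 - card (s \<inter> t)" using sub f v by (subst card_Diff_subset) auto
  finally have 1: "card (nb v \<inter> Neg) \<le> 4 - card (s \<inter> t)" .
  have "card (s \<union> t) \<le> 4" using card_mono[OF finite_nb sub] v by simp
  moreover have "card s + card t = card (s \<union> t) + card (s \<inter> t)" using f by (intro card_Un_Int)
  ultimately show ?thesis using 1 c by simp
next
  case True
  \<comment> \<open>In the complete link of \<open>v\<close> the point \<open>x\<close> has degree
    3, too much for \<open>v\<close> to be a wing of \<open>x\<close>.\<close>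
  have center: "\<exists>q r s. A_at x v q r s" if x: "x \<in> nb v" "typeA x" for x
  proof -
    obtain p q r s where A: "A_at x p q r s" using typeA_imp_A_at[OF x(2)] by blast
    have "v \<in> {p, q, r, s}" using A_at_nb[OF A] x(1) nb_sym by blast
    moreover have "lk_deg v x \<ge> 3" using lk_deg_of_complete_link v x(1) by blast
    then have "v \<noteq> r" "v \<noteq> s" using A_at_wing_deg[OF A] A_at_wing_deg[OF A_at_swap_wings[OF A]] by auto
    ultimately have "v = p \<or> v = q" by auto
    then show ?thesis using A A_at_swap_centers by blast
  qed
  obtain x where x: "x \<in> nb v" "typeA x" using True by blast
  then obtain q r s where A: "A_at x v q r s" using center by blast
  then have d: "distinct [x, v, q, r, s]" and F: "{x, v, q, r} \<in> \<F>" "{x, v, q, s} \<in> \<F>"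
    by (auto simp: A_at_def)
  have nbv: "nb v = {x, q, r, s}"
    using A_at_center(3)[OF A] d v by (intro card_seteq[symmetric]) auto
  have n: "{x, q, r} \<noteq> {x, q, s}"
  proof -
    have "r \<in> {x, q, r}" "r \<notin> {x, q, s}" using d by auto
    then show ?thesis by metis
  qed
  have "insert v {x, q, r} = {x, v, q, r}" "insert v {x, q, s} = {x, v, q, s}" by blast+
  then have s3: "{{x, q, r}, {x, q, s}} \<subseteq> lk 3 v" using d F by (auto simp: lk_def)
  have "card {{x, q, r}, {x, q, s}} = 2" using n by simp
  then have L3: "{{x, q, r}, {x, q, s}} = lk 3 v" using v s3 by (intro card_seteq) auto
  have w: "y \<notin> Neg" if y: "y \<in> {r, s}" for y
  proof
    assume N: "y \<in> Neg"
    have yn: "y \<in> nb v" using y nbv by auto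
    show False
    proof (cases "typeA y")
      case True
      then obtain q' r' s' where A': "A_at y v q' r' s'" using center yn by blast
      have l: "{y, q', r'} \<in> lk 3 v" "{y, q', s'} \<in> lk 3 v"
      proof -
        have "insert v {y, q', r'} = {y, v, q', r'}" "insert v {y, q', s'} = {y, v, q', s'}" by blast+
        then show "{y, q', r'} \<in> lk 3 v" "{y, q', s'} \<in> lk 3 v"
          using A' unfolding A_at_def lk_def by auto
      qed
      have "r' \<in> {y, q', r'}" "r' \<notin> {y, q', s'}" using A' unfolding A_at_def by auto
      then have "{y, q', r'} \<noteq> {y, q', s'}" by metis
      then have "card {{y, q', r'}, {y, q', s'}} = 2" by simp
      then have eq: "{{y, q', r'}, {y, q', s'}} = lk 3 v" using l v by (intro card_seteq) simp_all
      \<comment> \<open>Both triples at \<open>v\<close> come from the type A star of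
        \<open>y\<close>, so both contain \<open>y\<close>; but \<open>{x, q, r}\<close> and
        \<open>{x, q, s}\<close> share no wing.\<close>
      have yin: "y \<in> e" if "e \<in> lk 3 v" for e using that unfolding eq[symmetric] by auto
      have "y \<in> {x, q, r}" "y \<in> {x, q, s}" using s3 by (auto intro!: yin simp del: insert_iff)
      then show False using y d by auto
    next
      case False
      then have "typeB y" using N by (auto simp: Neg_def)
      \<comment> \<open>The complete link of \<open>y\<close> joins \<open>x\<close> to the other
        wing \<open>z\<close>, although no member through \<open>x\<close> contains both
        wings.\<close>
      obtain z where z: "z \<in> {r, s}" "z \<noteq> y" "{y, z} = {r, s}" using y d by auto
      have m: "{v, y, x} \<in> \<F>" "{v, y, z} \<in> \<F>"
        using all_triples_mem[OF v(3,2)] nbv y z d by auto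
      then have "x \<in> nb y" "z \<in> nb y" "x \<noteq> z"
        using mem_nb[OF m(1), of y x] mem_nb[OF m(2), of y z] y z d by auto
      then have "{y, x, z} \<in> \<F>" using all_triples_mem[of y x z] \<open>typeB y\<close> by (simp add: typeB_def)
      then show False using A_atD(2)[OF A, of "{y, x, z}"] z by auto
    qed
  qed
  have "nb v \<inter> Neg \<subseteq> {x, q}" using nbv w by auto
  then have "card (nb v \<inter> Neg) \<le> card {x, q}" by (intro card_mono) auto
  then show ?thesis using d by simp
qed

text \<open>Surplus against the largest possible total of payments: (4,6,2) has 24 against 16,
  (4,6,3) and above at least 54 against 32, (5,5,1) has 14 against 12, (5,6,0) has 24 against 24,
  and the other vertices with five neighbours at least 44 against 40.\<close>

lemma discharge:
  assumes v: "v \<in> Pos"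
  shows "(\<Sum>x\<in>nb v \<inter> Neg. pay x) < excess v \<or>
    (\<Sum>x\<in>nb v \<inter> Neg. pay x) = excess v \<and> da v = 5 \<and> db v = 6 \<and> dc v = 0 \<and>
    card (nb v \<inter> Neg) = 4 \<and> (\<forall>x\<in>nb v \<inter> Neg. pay x = 6)"
proof -
  define k where "k = card (nb v \<inter> Neg)"
  define S where "S = (\<Sum>x\<in>nb v \<inter> Neg. pay x)"
  have V: "v \<in> V" and na: "\<not> typeA v" "\<not> typeB v" using v by (auto simp: Pos_def Neg_def)
  have ka: "k \<le> da v" unfolding k_def by (intro card_mono) auto
  have S8: "S \<le> 8 * real k"
    using sum_bounded_above[of "nb v \<inter> Neg" pay 8] pay_le_8 by (simp add: S_def k_def mult.commute)
  have S6: "S \<le> 6 * real k" if "dc v \<le> 1" "da v \<le> 5"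
    using sum_bounded_above[of "nb v \<inter> Neg" pay 6] pay_le_6[OF _ _ v that] nb_sym
    by (simp add: S_def k_def mult.commute)
  from V consider "da v = 4" "db v = 6" "dc v \<ge> 2" | "da v = 5" "db v = 5" "dc v = 1"
    | "da v = 5" "db v = 6" "dc v = 0" | "da v = 5" "40 * db v + 30 * dc v \<ge> 260"
    | "da v \<ge> 6" "60 * da v + 40 * db v + 30 * dc v \<ge> 550"
    using link_cases[of v thesis for thesis] na unfolding typeA_def typeB_def by metis
  then have "S < excess v \<or> S = excess v \<and> da v = 5 \<and> db v = 6 \<and> dc v = 0 \<and>
    k = 4 \<and> (\<forall>x\<in>nb v \<inter> Neg. pay x = 6)"
  proof cases
    case 1
    show ?thesis
    proof (cases "dc v = 2")
      case True
      then have "k \<le> 2" using card_Neg_nb_le_2_462 V 1 by (simp add: k_def)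
      then show ?thesis using S8 1 True by (simp add: excess_def)
    next
      case False
      then have "dc v \<ge> 3" using 1 by simp
      then show ?thesis using S8 1 ka by (simp add: excess_def)
    qed
  next
    case 2
    then have "k \<le> 2" using card_Neg_nb_le_2_551 V by (simp add: k_def)
    then show ?thesis using S6 2 by (simp add: excess_def)
  next
    case 3
    then have k4: "k \<le> 4" using card_Neg_nb_le_4 by (simp add: k_def)
    have e: "excess v = 24" using 3 by (simp add: excess_def)
    have S6': "S \<le> 6 * real k" using S6 3 by simp
    show ?thesis
    proof (cases "k = 4 \<and> (\<forall>x\<in>nb v \<inter> Neg. pay x = 6)")
      case True
      then have "S = 24" by (simp add: S_def k_def)
      then show ?thesis using True 3 e by (simp add: k_def)
    next
      case False
      have "S < 24"
      proof (cases "k = 4")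
        case k: True
        then obtain x where x: "x \<in> nb v \<inter> Neg" "pay x \<noteq> 6" using False by blast
        have le: "pay y \<le> 6" if "y \<in> nb v \<inter> Neg" for y
          using pay_le_6[OF _ _ v, of y] that nb_sym[of v y] 3 by auto
        have "S < (\<Sum>x\<in>nb v \<inter> Neg. 6)"
          unfolding S_def using x le by (intro sum_strict_mono_ex1) force+
        then show ?thesis using k by (simp add: k_def)
      next
        case False
        then have "k \<le> 3" using k4 by simp
        then show ?thesis using S6' by simp
      qed
      then show ?thesis using e by simp
    qed
  next
    case 4
    then have "40 * real (db v) + 30 * real (dc v) \<ge> 260" by linarith
    then show ?thesis using S8 4 ka by (simp add: excess_def)
  next
    case 5
    \<comment> \<open>The surplus 34 covers four payments of 8. Five payers force
      \<open>db v\<close> to be at least 5 and the surplus to be at least 360 + 200 - 516 = 44 > 40;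
      six or more give 100k - 516 > 8k.\<close>
    have kb: "k \<le> db v" using card_Neg_nb_le_db by (simp add: k_def)
    have r: "real (da v) \<ge> 6" "real (da v) \<ge> real k" "real (db v) \<ge> real k" "real (dc v) \<ge> 0"
      "60 * real (da v) + 40 * real (db v) + 30 * real (dc v) \<ge> 550"
      using 5 ka kb by linarith+
    consider "k \<le> 4" | "k = 5" | "k \<ge> 6" by linarith
    then have "S < excess v"
    proof cases
      case 1 then show ?thesis using r S8 by (simp add: excess_def)
    next
      case 2 then show ?thesis using r S8 by (simp add: excess_def)
    next
      case 3
      then have "real k \<ge> 6" by simp
      then show ?thesis using r S8 unfolding excess_def by linarith
    qed
    then show ?thesis ..
  qed
  then show ?thesis by (simp add: S_def k_def)
qed

section \<open>Double counting the total charge\<close>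

lemma singleton_mem: assumes "v \<in> V" shows "{v} \<in> \<F>"
proof -
  have "card (link v) > 0" using deg[OF assms] unfolding degree_eq by linarith
  then have "link v \<noteq> {}" by (simp add: card_gt_0_iff)
  then obtain e where "insert v e \<in> \<F>" unfolding link_def by blast
  then show ?thesis using mem_mono[of "insert v e" "{v}"] by simp
qed

definition layer :: "nat \<Rightarrow> 'a set set" where
  "layer j = {G \<in> \<F>. card G = j}"

lemma finite_F: "finite \<F>"
  by (rule finite_subset[OF sub]) (simp add: finite_V)

lemma finite_mem: "G \<in> \<F> \<Longrightarrow> finite G"
  by (rule finite_subset[OF _ finite_V]) (use sub in auto)

lemma finite_in_lk: "e \<in> lk j v \<Longrightarrow> finite e"
  by (rule finite_subset[OF lk_sub finite_nb])

lemma finite_layer [simp]: "finite (layer j)"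
  using finite_F by (simp add: layer_def)

lemma card_lk_layer: "card {G \<in> layer (Suc j). v \<in> G} = card (lk j v)"
proof -
  have "bij_betw (insert v) (lk j v) {G \<in> layer (Suc j). v \<in> G}"
  proof (rule bij_betw_byWitness[where f' = "\<lambda>G. G - {v}"])
    show "insert v ` lk j v \<subseteq> {G \<in> layer (Suc j). v \<in> G}"
    proof
      fix G assume "G \<in> insert v ` lk j v"
      then obtain e where e: "e \<in> lk j v" "G = insert v e" by blast
      then show "G \<in> {G \<in> layer (Suc j). v \<in> G}"
        using finite_in_lk[OF e(1)] by (simp add: lk_def layer_def)
    qed
    show "(\<lambda>G. G - {v}) ` {G \<in> layer (Suc j). v \<in> G} \<subseteq> lk j v"
      by (auto simp: lk_def layer_def insert_absorb)
  qed (auto simp: lk_def)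
  then show ?thesis by (simp add: bij_betw_same_card)
qed

text \<open>Each member with \<open>j + 1\<close> points is counted once at each of them, so a
  weight of 120/(j + 1) per incidence gives every member a total of 120.\<close>

lemma sum_lk: "(\<Sum>v\<in>V. card (lk j v)) = Suc j * card (layer (Suc j))"
proof -
  have "(\<Sum>v\<in>V. card {G \<in> layer (Suc j). v \<in> G}) = Suc j * card (layer (Suc j))"
  proof (rule sum_multicount)
    show "\<forall>G\<in>layer (Suc j). card {v \<in> V. v \<in> G} = Suc j"
    proof
      fix G assume G: "G \<in> layer (Suc j)"
      then have "{v \<in> V. v \<in> G} = G" using sub by (auto simp: layer_def)
      then show "card {v \<in> V. v \<in> G} = Suc j" using G by (simp add: layer_def)
    qed
  qed (use finite_V in simp_all)
  then show ?thesis by (simp only: card_lk_layer)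
qed

lemma card_lk_1: "card (lk 1 v) = da v"
proof -
  have "lk 1 v = (\<lambda>y. {y}) ` nb v"
    by (auto simp: lk_def nb_def card_1_singleton_iff)
  then show ?thesis by (simp add: card_image)
qed

lemma card_lk_0: assumes "v \<in> V" shows "card (lk 0 v) = 1"
proof -
  have "lk 0 v = {{}}"
  proof
    show "lk 0 v \<subseteq> {{}}"
    proof
      fix e assume e: "e \<in> lk 0 v"
      then have "card e = 0" by (simp add: lk_def)
      then show "e \<in> {{}}" using finite_in_lk[OF e] by simp
    qed
  qed (use singleton_mem[OF assms] in \<open>simp add: lk_def\<close>)
  then show ?thesis by simp
qed

lemma card_F_ge: assumes "V \<noteq> {}"
  shows "card \<F> \<ge> 1 + card V + card (layer 2) + card (layer 3) + card (layer 4)"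
proof -
  have "{} \<in> \<F>" using assms singleton_mem mem_mono by blast
  then have 0: "card (layer 0) = 1"
  proof -
    have "layer 0 = {{}}" using \<open>{} \<in> \<F>\<close> finite_mem by (auto simp: layer_def)
    then show ?thesis by simp
  qed
  have 1: "card (layer 1) = card V" using sum_lk[of 0] card_lk_0 by simp
  have "(\<Union>j\<in>{..<5}. layer j) \<subseteq> \<F>" by (auto simp: layer_def)
  then have "card (\<Union>j\<in>{..<5}. layer j) \<le> card \<F>" using finite_F by (rule card_mono[rotated])
  moreover have "card (\<Union>j\<in>{..<5}. layer j) = (\<Sum>j<5. card (layer j))"
    by (rule card_UN_disjoint) (auto simp: layer_def finite_F)
  moreover have "(\<Sum>j<5. card (layer j)) = card (layer 0) + card (layer 1) + card (layer 2) + card (layer 3) + card (layer 4)"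
    by (simp add: eval_nat_numeral)
  ultimately show ?thesis using 0 1 by simp
qed

text \<open>60 * 2 = 40 * 3 = 30 * 4 = 120. The subtracted 1 is the empty set, and 516 = 636 - 120
  accounts for the singletons.\<close>

lemma sum_excess_le:
  assumes "V \<noteq> {}"
  shows "(\<Sum>v\<in>V. excess v) \<le> 120 * (real (card \<F>) - 1) - 636 * real (card V)"
proof -
  have a: "(\<Sum>v\<in>V. da v) = 2 * card (layer 2)" using sum_lk[of 1] by (simp only: card_lk_1) (simp add: numeral_2_eq_2)
  have b: "(\<Sum>v\<in>V. db v) = 3 * card (layer 3)" using sum_lk[of 2] by (simp add: numeral_3_eq_3 numeral_2_eq_2)
  have c: "(\<Sum>v\<in>V. dc v) = 4 * card (layer 4)" using sum_lk[of 3] by (simp add: eval_nat_numeral)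
  have "(\<Sum>v\<in>V. excess v) = 60 * real (\<Sum>v\<in>V. da v) + 40 * real (\<Sum>v\<in>V. db v) + 30 * real (\<Sum>v\<in>V. dc v) - 516 * real (card V)"
    by (simp add: excess_def sum.distrib sum_subtractf sum_distrib_left)
  also have "\<dots> = 120 * real (card (layer 2)) + 120 * real (card (layer 3)) + 120 * real (card (layer 4)) - 516 * real (card V)"
    unfolding a b c by simp
  finally show ?thesis using of_nat_mono[OF card_F_ge[OF assms], where ?'a = real] by simp
qed

text \<open>Conservation of charge: after paying, negative vertices are at zero, and the payments
  are regrouped by receiver.\<close>

lemma sum_excess_eq:
  "(\<Sum>v\<in>V. excess v) = (\<Sum>v\<in>Pos. excess v - (\<Sum>x\<in>nb v \<inter> Neg. pay x))"
proof -
  have fin: "finite Pos" "finite Neg" using finite_V by (auto simp: Pos_def Neg_def)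
  have V: "V = Pos \<union> Neg" and disj: "Pos \<inter> Neg = {}" by (auto simp: Pos_def Neg_def)
  have 1: "(\<Sum>v\<in>V. excess v) = (\<Sum>v\<in>Pos. excess v) + (\<Sum>x\<in>Neg. excess x)"
    using sum.union_disjoint[OF fin disj, of excess] sum.cong[OF V refl, of excess] by (rule trans[rotated])
  have "(\<Sum>x\<in>Neg. - excess x) = (\<Sum>x\<in>Neg. \<Sum>v | v \<in> Pos \<and> v \<in> nb x. pay x)"
  proof (rule sum.cong[OF refl])
    fix x assume "x \<in> Neg"
    \<comment> \<open>Only because the divisor in \<open>pay\<close> is nonzero do the shares add up
      to the whole deficit.\<close>
    then have "npos x \<noteq> 0" using npos_pos[of x] by linarith
    moreover have "{v. v \<in> Pos \<and> v \<in> nb x} = nb x \<inter> Pos" by blast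
    ultimately show "- excess x = (\<Sum>v | v \<in> Pos \<and> v \<in> nb x. pay x)" by (simp add: pay_def)
  qed
  also have "\<dots> = (\<Sum>v\<in>Pos. \<Sum>x | x \<in> Neg \<and> v \<in> nb x. pay x)"
    using fin by (rule sum.swap_restrict[rotated])
  also have "\<dots> = (\<Sum>v\<in>Pos. \<Sum>x\<in>nb v \<inter> Neg. pay x)"
  proof (rule sum.cong[OF refl])
    fix v
    have "{x. x \<in> Neg \<and> v \<in> nb x} = nb v \<inter> Neg" using nb_sym[of v] by blast
    then show "(\<Sum>x | x \<in> Neg \<and> v \<in> nb x. pay x) = (\<Sum>x\<in>nb v \<inter> Neg. pay x)" by simp
  qed
  finally show ?thesis using 1 by (simp add: sum_subtractf sum_negf)
qed

text \<open>The equality alternative of \<open>discharge\<close>.\<close>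

definition hub :: "'a \<Rightarrow> bool" where
  "hub v \<longleftrightarrow> da v = 5 \<and> db v = 6 \<and> dc v = 0 \<and>
    card (nb v \<inter> Neg) = 4 \<and> (\<forall>x\<in>nb v \<inter> Neg. pay x = 6)"

lemma sum_excess_nonneg: "(\<Sum>v\<in>V. excess v) \<ge> 0"
  unfolding sum_excess_eq
proof (rule sum_nonneg)
  fix v assume "v \<in> Pos"
  then show "0 \<le> excess v - (\<Sum>x\<in>nb v \<inter> Neg. pay x)" using discharge[of v] by auto
qed

text \<open>A vanishing sum of nonnegative balances has only zero terms, which leaves the equality
  alternative at every nonnegative vertex.\<close>

lemma sum_excess_zero:
  assumes "(\<Sum>v\<in>V. excess v) \<le> 0" "v \<in> Pos" shows "hub v"
proof -
  have fin: "finite Pos" using finite_V by (auto simp: Pos_def)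
  have "(\<Sum>v\<in>Pos. excess v - (\<Sum>x\<in>nb v \<inter> Neg. pay x)) = 0"
    using assms(1) sum_excess_nonneg sum_excess_eq by simp
  moreover have "excess v - (\<Sum>x\<in>nb v \<inter> Neg. pay x) \<ge> 0" if "v \<in> Pos" for v
    using discharge[OF that] by auto
  ultimately have "excess v - (\<Sum>x\<in>nb v \<inter> Neg. pay x) = 0"
    using sum_nonneg_eq_0_iff[OF fin] assms(2) by (metis (no_types, lifting))
  then show ?thesis using discharge[OF assms(2)] unfolding hub_def by linarith
qed

section \<open>Hubs\<close>

text \<open>Meaningful only when \<open>v\<close> has exactly one nonnegative neighbour, as hubs do.\<close>

definition mate :: "'a \<Rightarrow> 'a" where
  "mate v = the_elem (nb v \<inter> Pos)"

lemma mem_card_le_3: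
  assumes "dc v = 0" "G \<in> \<F>" "v \<in> G" shows "card G \<le> 3"
proof (rule ccontr)
  assume "\<not> ?thesis"
  then have "card (G - {v}) \<ge> 3" using assms finite_mem by (simp add: card_Diff_singleton)
  then obtain t where t: "t \<subseteq> G - {v}" "card t = 3" by (metis obtain_subset_with_card_n)
  then have "t \<in> lk 3 v" using mem_mono[OF assms(2), of "insert v t"] assms(3) by (auto simp: lk_def)
  then show False using assms(1) by auto
qed

context
  fixes v assumes vP: "v \<in> Pos" and hub: "hub v"
begin

text \<open>A hub has no triple, which excludes type A. A type B vertex that pays 6 gives its whole
  deficit to one receiver, and \<open>v\<close> is a receiver.\<close>

lemma hub_typeB: assumes "x \<in> nb v \<inter> Neg" shows "typeB x" "nb x \<inter> Pos = {v}"
proof -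
  have vx: "v \<in> nb x" using assms nb_sym by blast
  have "\<not> typeA x" using typeA_nb_dc[OF _ vx] hub by (auto simp: hub_def)
  moreover have "typeA x \<or> typeB x" using assms by (simp add: Neg_def)
  ultimately show B: "typeB x" by blast
  have "pay x = 6" using hub assms by (simp add: hub_def)
  then have "npos x = 1" using pay_typeB_eq B assms by blast
  then obtain w where "nb x \<inter> Pos = {w}" by (auto simp: card_1_singleton_iff)
  moreover have "v \<in> nb x \<inter> Pos" using vx vP by blast
  ultimately show "nb x \<inter> Pos = {v}" by (metis singletonD)
qed

lemma hub_lk_deg: assumes "x \<in> nb v \<inter> Neg" shows "lk_deg v x = 3"
proof -
  have vx: "v \<in> nb x" using assms nb_sym by blast
  have "da x = 4" "db x = 6" using hub_typeB[OF assms] by (auto simp: typeB_def)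
  then show ?thesis using lk_deg_at_complete_nb[OF _ _ vx] lk_deg_le[OF vx] by simp
qed

lemma hub_nb_split: "nb v = nb v \<inter> Neg \<union> nb v \<inter> Pos" "nb v \<inter> Neg \<inter> (nb v \<inter> Pos) = {}"
  using nb_sub[of v] by (auto simp: Pos_def)

lemma hub_mate: "nb v \<inter> Pos = {mate v}"
proof -
  have "card (nb v \<inter> Neg \<union> nb v \<inter> Pos) = card (nb v \<inter> Neg) + npos v"
    by (rule card_Un_disjoint) (use hub_nb_split in auto)
  then have "npos v = 1" using hub_nb_split(1) hub by (simp add: hub_def)
  then obtain w where "nb v \<inter> Pos = {w}" by (auto simp: card_1_singleton_iff)
  then show ?thesis by (simp add: mate_def)
qed

lemma mate_facts: "mate v \<in> Pos" "mate v \<in> nb v" "{v, mate v} \<in> \<F>" "mate v \<noteq> v"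
  using hub_mate by (auto simp: nb_def)

text \<open>The four negative neighbours, of degree 3 each, already use up the degree sum 12. So the
  mate is isolated in the link graph, and six edges on the other four points are all of
  them.\<close>

lemma hub_lk2: "lk 2 v = pairs (nb v \<inter> Neg)"
proof -
  have "(\<Sum>y\<in>nb v \<inter> Neg \<union> nb v \<inter> Pos. lk_deg v y)
      = (\<Sum>y\<in>nb v \<inter> Neg. lk_deg v y) + (\<Sum>y\<in>nb v \<inter> Pos. lk_deg v y)"
    by (rule sum.union_disjoint) (use hub_nb_split in auto)
  moreover have "(\<Sum>y\<in>nb v \<inter> Neg. lk_deg v y) = 12"
    using hub_lk_deg hub by (simp add: hub_def)
  ultimately have "lk_deg v (mate v) = 0"
    using lk_deg_sum[of v] hub_nb_split(1) hub_mate hub by (simp add: hub_def)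
  then have "e \<in> lk 2 v \<Longrightarrow> mate v \<notin> e" for e
    by (auto simp: lk_deg_def)
  then have "lk 2 v \<subseteq> pairs (nb v \<inter> Neg)"
  proof (intro subsetI)
    fix e assume e: "e \<in> lk 2 v" and *: "\<And>e. e \<in> lk 2 v \<Longrightarrow> mate v \<notin> e"
    have "e \<subseteq> nb v" "card e = 2" "mate v \<notin> e" using lk_sub[OF e] e *[OF e] by (auto simp: lk_def)
    moreover have "nb v = nb v \<inter> Neg \<union> {mate v}" using hub_nb_split(1) hub_mate by simp
    ultimately have "e \<subseteq> nb v \<inter> Neg" by blast
    then show "e \<in> pairs (nb v \<inter> Neg)" using \<open>card e = 2\<close> by (simp add: pairs_def)
  qed
  moreover have "card (pairs (nb v \<inter> Neg)) = 6" using hub by (simp add: hub_def card_pairs choose_two)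
  ultimately show ?thesis using hub by (intro card_subset_eq) (auto simp: hub_def finite_pairs)
qed

lemma hub_nb: assumes x: "x \<in> nb v \<inter> Neg" shows "nb x = insert v (nb v \<inter> Neg - {x})"
proof (rule card_seteq[symmetric])
  have 4: "card (nb v \<inter> Neg) = 4" using hub by (simp add: hub_def)
  show "insert v (nb v \<inter> Neg - {x}) \<subseteq> nb x"
  proof
    fix y assume y: "y \<in> insert v (nb v \<inter> Neg - {x})"
    show "y \<in> nb x"
    proof (cases "y = v")
      case True then show ?thesis using x nb_sym by blast
    next
      case False
      then have "{x, y} \<in> pairs (nb v \<inter> Neg)" using x y by (intro pairs_insert_mem) auto
      then have "{v, x, y} \<in> \<F>" using lk2_D hub_lk2 by blast
      then show ?thesis using mem_nb[of "{v, x, y}" x y] y False by auto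
    qed
  qed
  have "v \<notin> nb v" by (simp add: nb_def)
  then show "da x \<le> card (insert v (nb v \<inter> Neg - {x}))"
    using hub_typeB[OF x] x 4 by (simp add: typeB_def)
qed simp

text \<open>The triple of a type B neighbour \<open>x\<close> avoids \<open>v\<close>, because
  \<open>dc v = 0\<close>; the only points left for it are the other three negative neighbours of
  \<open>v\<close>.\<close>

lemma hub_Neg_mem: "nb v \<inter> Neg \<in> \<F>"
proof -
  have 4: "card (nb v \<inter> Neg) = 4" using hub by (simp add: hub_def)
  then have "nb v \<inter> Neg \<noteq> {}" by auto
  then obtain x where x: "x \<in> nb v \<inter> Neg" by blast
  have "dc x = 1" using hub_typeB[OF x] by (simp add: typeB_def)
  then obtain t where "lk 3 x = {t}" by (auto simp: card_1_singleton_iff)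
  then have t: "t \<in> lk 3 x" by simp
  then have c: "card t = 3" "x \<notin> t" and F: "insert x t \<in> \<F>" by (auto simp: lk_def)
  have "v \<notin> t"
  proof
    assume "v \<in> t"
    moreover have "dc v = 0" using hub by (simp add: hub_def)
    ultimately have "card (insert x t) \<le> 3" by (intro mem_card_le_3[OF _ F, of v]) auto
    then show False using c finite_in_lk[OF t] by simp
  qed
  have "t \<subseteq> insert v (nb v \<inter> Neg - {x})" using lk_sub[OF t] hub_nb[OF x] by simp
  then have "insert x t \<subseteq> nb v \<inter> Neg" using x \<open>v \<notin> t\<close> by blast
  moreover have "card (insert x t) = 4" using c finite_in_lk[OF t] by simp
  ultimately have "insert x t = nb v \<inter> Neg" using 4 by (intro card_seteq) auto
  then show ?thesis using F by simp
qed

lemma hub_small_mem: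
  assumes S: "S \<subseteq> insert v (nb v \<inter> Neg)" "card S \<le> 3" shows "S \<in> \<F>"
proof (cases "v \<in> S")
  case False
  then have "S \<subseteq> nb v \<inter> Neg" using S by blast
  then show ?thesis using mem_mono[OF hub_Neg_mem] by blast
next
  case True
  have 4: "card (nb v \<inter> Neg) = 4" using hub by (simp add: hub_def)
  have "finite S" using S(1) finite_subset by fastforce
  then have "card (S - {v}) \<le> 2" using S(2) True by simp
  moreover have "S - {v} \<subseteq> nb v \<inter> Neg" using S by blast
  \<comment> \<open>The at most two points besides \<open>v\<close> are padded to an edge of the
    K4.\<close>
  ultimately obtain e where e: "S - {v} \<subseteq> e" "e \<subseteq> nb v \<inter> Neg" "card e = 2"
    using exists_subset_between[of "S - {v}" 2 "nb v \<inter> Neg"] 4 by auto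
  then have "e \<in> lk 2 v" by (simp add: hub_lk2 pairs_def)
  then have "insert v e \<in> \<F>" by (simp add: lk_def)
  then show ?thesis using mem_mono[of "insert v e" S] e(1) by blast
qed

text \<open>A third point would give a link edge at the mate, which is isolated there.\<close>

lemma hub_mate_only: assumes "G \<in> \<F>" "v \<in> G" "mate v \<in> G" shows "G = {v, mate v}"
proof (rule ccontr)
  assume "G \<noteq> {v, mate v}"
  then obtain z where z: "z \<in> G" "z \<noteq> v" "z \<noteq> mate v" using assms by blast
  then have "{v, mate v, z} \<in> \<F>" using mem_mono[OF assms(1), of "{v, mate v, z}"] assms by blast
  then have "{mate v, z} \<in> lk 2 v" using z mate_facts(4) in_lk2[OF _ refl, of v "mate v" z] by simp
  then have "mate v \<in> Neg" by (auto simp: hub_lk2 pairs_def)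
  then show False using mate_facts(1) by (simp add: Pos_def)
qed

end

text \<open>\<open>v\<close> is a nonnegative neighbour of its mate, and a hub has only one such
  neighbour.\<close>

lemma mate_mate:
  assumes "v \<in> Pos" "hub v" "hub (mate v)" shows "mate (mate v) = v"
proof -
  have "v \<in> nb (mate v)" using mate_facts(2)[OF assms(1,2)] nb_sym by blast
  then have "v \<in> nb (mate v) \<inter> Pos" using assms(1) by blast
  then show ?thesis using hub_mate[OF mate_facts(1)[OF assms(1,2)] assms(3)] by (metis singletonD)
qed

lemma hub_disjoint:
  assumes "v \<in> Pos" "hub v" "w \<in> Pos" "hub w" "x \<in> nb v \<inter> Neg" "x \<in> nb w \<inter> Neg"
  shows "v = w"
  using hub_typeB(2)[OF assms(1,2,5)] hub_typeB(2)[OF assms(3,4,6)] by blast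

lemma V_blocks: "V = (\<Union>v\<in>Pos. insert v (nb v \<inter> Neg))"
proof
  show "(\<Union>v\<in>Pos. insert v (nb v \<inter> Neg)) \<subseteq> V" by (auto simp: Pos_def Neg_def)
  show "V \<subseteq> (\<Union>v\<in>Pos. insert v (nb v \<inter> Neg))"
  proof
    fix x assume "x \<in> V"
    show "x \<in> (\<Union>v\<in>Pos. insert v (nb v \<inter> Neg))"
    proof (cases "x \<in> Pos")
      case False
      then have "x \<in> Neg" using \<open>x \<in> V\<close> by (simp add: Pos_def)
      then have "nb x \<inter> Pos \<noteq> {}" using npos_pos[of x] by (metis card.empty not_one_le_zero)
      then obtain v where "v \<in> nb x" "v \<in> Pos" by blast
      then show ?thesis using \<open>x \<in> Neg\<close> nb_sym by blast
    qed blast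
  qed
qed

text \<open>A member through a negative \<open>x\<close> stays in the block of \<open>x\<close>,
  since the neighbours of \<open>x\<close> do; with four or more points it must avoid the hub and is
  then the whole K4. A member made of hubs only is a singleton or a pair of mates.\<close>

lemma F_blocks:
  assumes "V \<noteq> {}" and hubs: "\<And>v. v \<in> Pos \<Longrightarrow> hub v"
  shows "\<F> = {S. \<exists>v\<in>Pos. S \<subseteq> insert v (nb v \<inter> Neg) \<and> card S \<le> 3}
    \<union> (\<lambda>v. nb v \<inter> Neg) ` Pos \<union> (\<lambda>v. {v, mate v}) ` Pos" (is "\<F> = ?R")
proof
  show "?R \<subseteq> \<F>"
    using hub_small_mem hub_Neg_mem mate_facts(3) hubs by blast
  show "\<F> \<subseteq> ?R"
  proof
    fix G assume G: "G \<in> \<F>"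
    then have GV: "G \<subseteq> V" using sub by blast
    consider "G = {}" | x where "x \<in> G" "x \<in> Neg" | v where "v \<in> G" "G \<subseteq> Pos"
      using GV by (auto simp: Pos_def)
    then show "G \<in> ?R"
    proof cases
      case 1
      obtain v where "v \<in> Pos" using assms(1) V_blocks by blast
      then show ?thesis using 1 by auto
    next
      case 2
      then have "x \<in> V" "x \<notin> Pos" by (auto simp: Pos_def Neg_def)
      then obtain v where v: "v \<in> Pos" "x \<in> nb v \<inter> Neg" using V_blocks by blast
      note h = v(1) hubs[OF v(1)]
      have Gs: "G \<subseteq> insert v (nb v \<inter> Neg)"
        using subset_insert_nb[OF G 2(1)] hub_nb[OF h v(2)] v(2) by blast
      have 4: "card (nb v \<inter> Neg) = 4" and "dc v = 0" using h(2) by (auto simp: hub_def)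
      show ?thesis
      proof (cases "card G \<le> 3")
        case True then show ?thesis using Gs v by blast
      next
        case False
        then have "v \<notin> G" using mem_card_le_3[OF \<open>dc v = 0\<close> G] by blast
        then have "G \<subseteq> nb v \<inter> Neg" using Gs by blast
        then have "G = nb v \<inter> Neg" using False 4 by (intro card_seteq) auto
        then show ?thesis using v by blast
      qed
    next
      case 3
      note v = subsetD[OF 3(2,1)]
      show ?thesis
      proof (cases "G = {v}")
        case True then show ?thesis using v by auto
      next
        case False
        then obtain w where w: "w \<in> G" "w \<noteq> v" using 3 by blast
        then have "w \<in> nb v \<inter> Pos" using mem_nb[OF G 3(1)] 3(2) by blast
        then have "w = mate v" using hub_mate[OF v hubs[OF v]] by blast
        then have "G = {v, mate v}" using hub_mate_only[OF v hubs[OF v] G 3(1)] w by blast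
        then show ?thesis using v by blast
      qed
    qed
  qed
qed

end

section \<open>Recognising the extremal family\<close>

text \<open>Induction that removes one orbit \<open>{v, m v}\<close> at a time.\<close>

lemma involution_enumeration:
  assumes "finite H" "\<And>v. v \<in> H \<Longrightarrow> m v \<in> H \<and> m v \<noteq> v \<and> m (m v) = v"
  shows "\<exists>k h. bij_betw h {1..2 * k} H \<and> (\<forall>i\<in>{1..2 * k :: nat}. odd i \<longrightarrow> h (i + 1) = m (h i))"
  using assms
proof (induction "card H" arbitrary: H rule: less_induct)
  case less
  show ?case
  proof (cases "H = {}")
    case True
    then have "bij_betw (\<lambda>_. undefined) {1..2 * (0::nat)} H" by (simp add: bij_betw_def)
    then show ?thesis by fastforce
  next
    case False
    then obtain v where v: "v \<in> H" by blast
    note m = less.prems(2)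
    let ?H = "H - {v, m v}"
    have "card ?H < card H" using v less.prems(1) by (intro psubset_card_mono) auto
    moreover have "m u \<in> ?H \<and> m u \<noteq> u \<and> m (m u) = u" if "u \<in> ?H" for u
      using m[of u] m[OF v] that by auto
    ultimately obtain k :: nat and h where h: "bij_betw h {1..2 * k} ?H"
      "\<And>i. i \<in> {1..2 * k} \<Longrightarrow> odd i \<Longrightarrow> h (i + 1) = m (h i)"
      using less.hyps[of ?H] less.prems(1) by blast
    \<comment> \<open>The removed orbit takes the two new last positions, the odd one being
      \<open>2 * k + 1\<close>.\<close>
    define h' where "h' = (\<lambda>i. if i = 2 * k + 1 then v else if i = 2 * k + 2 then m v else h i)"
    have "bij_betw h' {1..2 * k} ?H"
      using h(1) by (rule bij_betw_cong[THEN iffD1, rotated]) (simp add: h'_def)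
    moreover have "bij_betw h' {2 * k + 1, 2 * k + 2} {v, m v}"
      using m[OF v] by (auto simp: bij_betw_def h'_def)
    ultimately have "bij_betw h' ({1..2 * k} \<union> {2 * k + 1, 2 * k + 2}) (?H \<union> {v, m v})"
      by (rule bij_betw_combine) blast
    moreover have "{1..2 * k} \<union> {2 * k + 1, 2 * k + 2} = {1..2 * Suc k}" by auto
    moreover have "?H \<union> {v, m v} = H" using v m[OF v] by blast
    ultimately have "bij_betw h' {1..2 * Suc k} H" by simp
    moreover have "h' (i + 1) = m (h' i)" if i: "i \<in> {1..2 * Suc k}" "odd i" for i
    proof (cases "i = 2 * k + 1")
      case True then show ?thesis by (simp add: h'_def)
    next
      case False
      have "i \<noteq> 2 * k" "i \<noteq> 2 * k + 2" using i(2) by auto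
      then have "i \<le> 2 * k" "i + 1 \<le> 2 * k" using i(1) False by auto
      then show ?thesis using h(2)[of i] i by (simp add: h'_def)
    qed
    ultimately show ?thesis by blast
  qed
qed

lemma mem_blockU:
  assumes "i \<ge> 1"
  shows "t \<in> blockU 5 i \<longleftrightarrow> t \<ge> 1 \<and> (t - 1) div 5 + 1 = i"
proof -
  obtain j where "i = Suc j" using assms by (cases i) auto
  then show ?thesis by (auto simp: blockU_def)
qed

lemma Union_blockU: "(\<Union>i\<in>{1..N}. blockU 5 i) = {1..5 * N}"
proof
  show "(\<Union>i\<in>{1..N}. blockU 5 i) \<subseteq> {1..5 * N}" by (auto simp: blockU_def)
  show "{1..5 * N} \<subseteq> (\<Union>i\<in>{1..N}. blockU 5 i)"
  proof
    fix t assume t: "t \<in> {1..5 * N}"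
    then have "(t - 1) div 5 + 1 \<in> {1..N}" by auto
    moreover have "t \<in> blockU 5 ((t - 1) div 5 + 1)" using t by (subst mem_blockU) auto
    ultimately show "t \<in> (\<Union>i\<in>{1..N}. blockU 5 i)" by blast
  qed
qed

lemma bij_betw_shift_blockU:
  assumes "i \<ge> 1" shows "bij_betw (\<lambda>t. (t - 1) mod 5 + 1) (blockU 5 i) {1..5}"
proof -
  obtain j where i: "i = Suc j" using assms by (cases i) auto
  show ?thesis
  proof (rule bij_betw_byWitness[where f' = "\<lambda>r. 5 * j + r"])
    have "(t - 1) mod 5 + 1 = t - 5 * j" if "t \<in> blockU 5 i" for t
    proof -
      have "(t - 1) div 5 = j" "t \<ge> 1" using that i mem_blockU[of i t] by auto
      then show ?thesis using div_mult_mod_eq[of "t - 1" 5] by simp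
    qed
    then show "\<forall>t\<in>blockU 5 i. 5 * j + ((t - 1) mod 5 + 1) = t"
      by (auto simp: i blockU_def)
    have "(5 * j + r - 1) mod 5 + 1 = r" if "r \<in> {1..5}" for r
    proof -
      have "5 * j + r - 1 = (r - 1) + 5 * j" using that by simp
      then show ?thesis using that by (simp only: mod_mult_self2) auto
    qed
    then show "\<forall>r\<in>{1..5}. (5 * j + r - 1) mod 5 + 1 = r" by blast
  qed (auto simp: i blockU_def)
qed

text \<open>\<open>H\<close> stands for the hubs, \<open>X v\<close> for the K4 of \<open>v\<close>,
  \<open>m\<close> for the matching. The map is built from the integers to \<open>V\<close>, where
  block and position come from arithmetic, and is inverted at the end.\<close>

lemma block_family_iso_F0:
  fixes H V :: "'a set" and X :: "'a \<Rightarrow> 'a set" and m :: "'a \<Rightarrow> 'a"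
  assumes fin: "finite H"
    and m: "\<And>v. v \<in> H \<Longrightarrow> m v \<in> H \<and> m v \<noteq> v \<and> m (m v) = v"
    and X4: "\<And>v. v \<in> H \<Longrightarrow> card (X v) = 4"
    and XH: "\<And>v. v \<in> H \<Longrightarrow> X v \<inter> H = {}"
    and XX: "\<And>v w. v \<in> H \<Longrightarrow> w \<in> H \<Longrightarrow> v \<noteq> w \<Longrightarrow> X v \<inter> X w = {}"
    and V: "V = (\<Union>v\<in>H. insert v (X v))"
    and F: "\<F> = {S. \<exists>v\<in>H. S \<subseteq> insert v (X v) \<and> card S \<le> 3} \<union> X ` H \<union> (\<lambda>v. {v, m v}) ` H"
  shows "10 dvd card V \<and> (\<exists>f. bij_betw f V {1..card V} \<and> (\<lambda>S. f ` S) ` \<F> = F0 (card V) 5)"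
proof -
  obtain k :: nat and h where h: "bij_betw h {1..2 * k} H"
    and hm: "\<And>i. i \<in> {1..2 * k} \<Longrightarrow> odd i \<Longrightarrow> h (i + 1) = m (h i)"
    using involution_enumeration[OF fin, of m] m by blast
  have hH: "h i \<in> H" if "i \<in> {1..2 * k}" for i using h that by (auto simp: bij_betw_def)
  have Hh: "h ` {1..2 * k} = H" using h by (simp add: bij_betw_def)
  have finX: "finite (X v)" if "v \<in> H" for v using X4[OF that] card_ge_0_finite[of "X v"] by simp
  have "\<exists>g. bij_betw g {1..4::nat} (X v)" if "v \<in> H" for v
    using ex_bij_betw_nat_finite_1[OF finX[OF that]] X4[OF that] by simp
  then obtain g where g: "\<And>v. v \<in> H \<Longrightarrow> bij_betw (g v) {1..4::nat} (X v)" by metis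
  \<comment> \<open>F0 singles out the last point \<open>5 * i\<close> of a block, so the hub gets
    position 5.\<close>
  define g' where "g' = (\<lambda>v j. if j = 5 then v else g v j)"
  have g': "bij_betw (g' v) {1..5} (insert v (X v))" if "v \<in> H" for v
  proof -
    have "bij_betw (g' v) {1..4} (X v)"
      using g[OF that] by (rule bij_betw_cong[THEN iffD1, rotated]) (simp add: g'_def)
    moreover have "bij_betw (g' v) {5} {v}" by (simp add: g'_def bij_betw_def)
    ultimately have "bij_betw (g' v) ({1..4} \<union> {5}) (X v \<union> {v})"
      by (rule bij_betw_combine) (use XH[OF that] that in blast)
    moreover have "{1..4} \<union> {5} = {1..5::nat}" by auto
    ultimately show ?thesis by simp
  qed
  \<comment> \<open>Blocks start at 1 modulo 5, hence quotient and remainder of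
    \<open>t - 1\<close>.\<close>
  define \<phi> where "\<phi> = (\<lambda>t. g' (h ((t - 1) div 5 + 1)) ((t - 1) mod 5 + 1))"
  have \<phi>U: "bij_betw \<phi> (blockU 5 i) (insert (h i) (X (h i)))" if i: "i \<in> {1..2 * k}" for i
  proof -
    have "bij_betw (g' (h i) \<circ> (\<lambda>t. (t - 1) mod 5 + 1)) (blockU 5 i) (insert (h i) (X (h i)))"
      using i by (intro bij_betw_trans[OF bij_betw_shift_blockU g'] hH) auto
    then show ?thesis
      by (rule bij_betw_cong[THEN iffD1, rotated]) (use i in \<open>simp add: \<phi>_def mem_blockU\<close>)
  qed
  have \<phi>5: "\<phi> (5 * i) = h i" if i: "i \<in> {1..2 * k}" for i
  proof -
    obtain j where j: "i = Suc j" using i by (cases i) auto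
    then have "(5 * i - 1) div 5 = j" "(5 * i - 1) mod 5 = 4" by auto
    then show ?thesis by (simp add: \<phi>_def g'_def j)
  qed
  let ?n = "10 * k"
  have cV: "card V = ?n"
  proof -
    have "card V = (\<Sum>v\<in>H. card (insert v (X v)))"
      unfolding V using fin finX XH XX by (intro card_UN_disjoint) auto
    also have "\<dots> = (\<Sum>v\<in>H. 5)"
    proof (rule sum.cong[OF refl])
      fix v assume v: "v \<in> H"
      then have "v \<notin> X v" using XH by blast
      then show "card (insert v (X v)) = 5" using finX[OF v] X4[OF v] by simp
    qed
    also have "\<dots> = ?n" using bij_betw_same_card[OF h] by simp
    finally show ?thesis .
  qed
  have UU: "(\<Union>i\<in>{1..2 * k}. blockU 5 i) = {1..?n}" using Union_blockU[of "2 * k"] by simp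
  have img: "\<phi> ` {1..?n} = V"
  proof -
    have "\<phi> ` {1..?n} = (\<Union>i\<in>{1..2 * k}. \<phi> ` blockU 5 i)" by (simp only: UU[symmetric] image_UN)
    also have "\<dots> = (\<Union>i\<in>{1..2 * k}. insert (h i) (X (h i)))"
      using \<phi>U by (intro SUP_cong) (auto simp: bij_betw_def)
    also have "\<dots> = V" unfolding V Hh[symmetric] by blast
    finally show ?thesis .
  qed
  \<comment> \<open>A surjection between finite sets of equal size.\<close>
  have inj: "inj_on \<phi> {1..?n}" using img cV by (intro eq_card_imp_inj_on) auto
  have \<phi>: "bij_betw \<phi> {1..?n} V" using inj img by (simp add: bij_betw_def)
  have Usub: "blockU 5 i \<subseteq> {1..?n}" if "i \<in> {1..2 * k}" for i using UU that by blast
  have F0: "F0 ?n 5 = {S. \<exists>i\<in>{1..2 * k}. S \<subseteq> blockU 5 i \<and> card S \<le> 3}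
     \<union> {blockU 5 i - {5 * i} | i. i \<in> {1..2 * k}}
     \<union> {{5 * i, 5 * (i + 1)} | i. i \<in> {1..2 * k} \<and> odd i}" (is "_ = ?A \<union> ?B \<union> ?C")
    by (simp add: F0_def)
  have A: "(`) \<phi> ` ?A = {S. \<exists>v\<in>H. S \<subseteq> insert v (X v) \<and> card S \<le> 3}"
  proof (intro equalityI subsetI)
    fix S assume "S \<in> (`) \<phi> ` ?A"
    then obtain T i where T: "S = \<phi> ` T" "i \<in> {1..2 * k}" "T \<subseteq> blockU 5 i" "card T \<le> 3" by blast
    have "finite T" using T(3) by (rule finite_subset) (simp add: blockU_def)
    then have "card S \<le> 3" using T card_image_le[of T \<phi>] by simp
    moreover have "S \<subseteq> insert (h i) (X (h i))" using \<phi>U[OF T(2)] T by (auto simp: bij_betw_def)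
    ultimately show "S \<in> {S. \<exists>v\<in>H. S \<subseteq> insert v (X v) \<and> card S \<le> 3}" using hH[OF T(2)] by blast
  next
    fix S assume "S \<in> {S. \<exists>v\<in>H. S \<subseteq> insert v (X v) \<and> card S \<le> 3}"
    then obtain i where i: "i \<in> {1..2 * k}" "S \<subseteq> insert (h i) (X (h i))" "card S \<le> 3"
      using Hh by blast
    then have "S \<subseteq> \<phi> ` blockU 5 i" using \<phi>U[OF i(1)] by (simp add: bij_betw_def)
    then obtain T where T: "T \<subseteq> blockU 5 i" "S = \<phi> ` T" by (meson subset_imageE)
    then have "card S = card T"
      using card_image inj_on_subset \<phi>U[OF i(1)] unfolding bij_betw_def by blast
    then have "T \<in> ?A" using T(1) i(1,3) by auto
    with T(2) show "S \<in> (`) \<phi> ` ?A" by (rule image_eqI)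
  qed
  have B: "(`) \<phi> ` ?B = X ` H"
  proof -
    have "\<phi> ` (blockU 5 i - {5 * i}) = X (h i)" if i: "i \<in> {1..2 * k}" for i
    proof -
      have "5 * i \<in> blockU 5 i" using i by (auto simp: blockU_def)
      then have "\<phi> ` (blockU 5 i - {5 * i}) = \<phi> ` blockU 5 i - \<phi> ` {5 * i}"
        using \<phi>U[OF i] by (intro inj_on_image_set_diff[of _ "blockU 5 i"]) (auto simp: bij_betw_def)
      also have "\<dots> = insert (h i) (X (h i)) - {h i}" using \<phi>U[OF i] \<phi>5[OF i] by (simp add: bij_betw_def)
      also have "\<dots> = X (h i)" using XH[OF hH[OF i]] hH[OF i] by blast
      finally show ?thesis .
    qed
    then have "(\<lambda>i. \<phi> ` (blockU 5 i - {5 * i})) ` {1..2 * k} = (\<lambda>i. X (h i)) ` {1..2 * k}"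
      by (intro image_cong) auto
    moreover have "?B = (\<lambda>i. blockU 5 i - {5 * i}) ` {1..2 * k}" by (rule Setcompr_eq_image)
    ultimately show ?thesis unfolding Hh[symmetric] by (simp only: image_image)
  qed
  have C: "(`) \<phi> ` ?C = (\<lambda>v. {v, m v}) ` H"
  proof -
    have *: "\<phi> ` {5 * i, 5 * (i + 1)} = {h i, m (h i)}" if i: "i \<in> {1..2 * k}" "odd i" for i
    proof -
      \<comment> \<open>The last index is even, so an odd \<open>i\<close> has its successor in
        range.\<close>
      have "i \<noteq> 2 * k" using i by auto
      then have "i + 1 \<in> {1..2 * k}" using i by auto
      then show ?thesis using \<phi>5[of "i + 1"] \<phi>5[of i] hm[of i] i by simp
    qed
    show ?thesis
    proof (intro equalityI subsetI)
      fix S assume "S \<in> (`) \<phi> ` ?C"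
      then obtain i where "i \<in> {1..2 * k}" "odd i" "S = \<phi> ` {5 * i, 5 * (i + 1)}" by blast
      then show "S \<in> (\<lambda>v. {v, m v}) ` H" using * hH by blast
    next
      fix S assume "S \<in> (\<lambda>v. {v, m v}) ` H"
      then obtain j where j: "j \<in> {1..2 * k}" "S = {h j, m (h j)}" using Hh by blast
      have "\<exists>i\<in>{1..2 * k}. odd i \<and> S = {h i, m (h i)}"
      proof (cases "odd j")
        case True then show ?thesis using j by blast
      next
        case False
        \<comment> \<open>For even \<open>j\<close> the pair is listed under \<open>j - 1\<close>;
          here \<open>j\<close> is at least 2, so the subtraction does not truncate.\<close>
        then have i: "j - 1 \<in> {1..2 * k}" "odd (j - 1)" "j - 1 + 1 = j" using j by (auto elim: evenE)
        then have "h j = m (h (j - 1))" using hm[of "j - 1"] by simp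
        then have "S = {h (j - 1), m (h (j - 1))}" using j m[OF hH[OF i(1)]] by auto
        then show ?thesis using i by blast
      qed
      then obtain i where "i \<in> {1..2 * k}" "odd i" "S = \<phi> ` {5 * i, 5 * (i + 1)}" using * by metis
      then show "S \<in> (`) \<phi> ` ?C" by blast
    qed
  qed
  have FF: "(`) \<phi> ` F0 ?n 5 = \<F>" unfolding F0 F by (simp only: image_Un A B C)
  define f where "f = the_inv_into {1..?n} \<phi>"
  have f: "bij_betw f V {1..?n}" unfolding f_def by (rule bij_betw_the_inv_into[OF \<phi>])
  have "f ` \<phi> ` T = T" if "T \<in> F0 ?n 5" for T
  proof -
    have "T \<subseteq> {1..?n}" using that unfolding F0
    proof (elim UnE)
      assume "T \<in> ?C"
      then obtain i where i: "i \<in> {1..2 * k}" "odd i" "T = {5 * i, 5 * (i + 1)}" by blast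
      then have "i \<noteq> 2 * k" by auto
      then show ?thesis using i by auto
    qed (use Usub in blast)+
    then have "f (\<phi> t) = t" if "t \<in> T" for t
      using the_inv_into_f_f[OF inj, of t] that unfolding f_def by blast
    then show ?thesis by (simp add: image_image)
  qed
  then have "(`) f ` (`) \<phi> ` F0 ?n 5 = F0 ?n 5" by (simp add: image_image)
  then have "(`) f ` \<F> = F0 ?n 5" by (simp only: FF)
  then show ?thesis using f cV by auto
qed

theorem mainTheorem4:
  fixes V :: "'a set" and \<F> :: "'a set set" and n :: nat
  assumes "n > 0" and "finite V" and "card V = n"
    and "\<F> \<subseteq> Pow V" and "hereditary \<F>"
    and "min_degree V \<F> \<ge> 12"
    and "real (card \<F>) \<le> 53 / 10 * real n + 1"
  shows "10 dvd n \<and> real (card \<F>) = 53 / 10 * real n + 1 \<and>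
         (\<exists>f. bij_betw f V {1..n} \<and> (\<lambda>S. f ` S) ` \<F> = F0 n 5)"
proof -
  have "V \<noteq> {}" using assms(1,3) by auto
  have "degree \<F> v \<ge> 12" if "v \<in> V" for v
  proof -
    have "min_degree V \<F> \<le> degree \<F> v"
      unfolding min_degree_def using assms(2) that by (intro Min_le) auto
    then show ?thesis using assms(6) by linarith
  qed
  then interpret hereditary_family V \<F>
    using assms(2,4,5) by unfold_locales
  have le: "(\<Sum>v\<in>V. excess v) \<le> 120 * (real (card \<F>) - 1) - 636 * real n"
    using sum_excess_le[OF \<open>V \<noteq> {}\<close>] assms(3) by simp
  \<comment> \<open>120 * 5.3 = 636.\<close>
  have "120 * (real (card \<F>) - 1) \<le> 636 * real n" using assms(7) by simp
  with le have nonpos: "(\<Sum>v\<in>V. excess v) \<le> 0" by linarith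
  have hubs: "hub v" if "v \<in> Pos" for v using sum_excess_zero[OF nonpos that] .
  have card: "real (card \<F>) = 53 / 10 * real n + 1"
  proof -
    have "120 * (real (card \<F>) - 1) \<ge> 636 * real n" using le sum_excess_nonneg by linarith
    then show ?thesis using assms(7) by simp
  qed
  have "10 dvd card V \<and> (\<exists>f. bij_betw f V {1..card V} \<and> (\<lambda>S. f ` S) ` \<F> = F0 (card V) 5)"
  proof (rule block_family_iso_F0[where H = Pos and X = "\<lambda>v. nb v \<inter> Neg" and m = mate])
    show "finite Pos" using assms(2) by (simp add: Pos_def)
    show "mate v \<in> Pos \<and> mate v \<noteq> v \<and> mate (mate v) = v" if "v \<in> Pos" for v
      using mate_facts[OF that hubs[OF that]] mate_mate[OF that] hubs that by blast
    show "card (nb v \<inter> Neg) = 4" if "v \<in> Pos" for v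
      using hubs[OF that] by (simp add: hub_def)
    show "nb v \<inter> Neg \<inter> Pos = {}" for v by (auto simp: Pos_def)
    show "(nb v \<inter> Neg) \<inter> (nb w \<inter> Neg) = {}" if "v \<in> Pos" "w \<in> Pos" "v \<noteq> w" for v w
      using hub_disjoint[OF that(1) hubs[OF that(1)] that(2) hubs[OF that(2)]] that(3) by blast
  qed (use V_blocks F_blocks[OF \<open>V \<noteq> {}\<close> hubs] in auto)
  then show ?thesis using card assms(3) by simp
qed

end
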